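(* Let $G=(V,E)$ be a finite simple graph with $E\neq\emptyset$ and let $\mathfrak n_G$ be the real 2-step nilpotent Lie algebra associated with $G$. Then $\mathfrak n_G$ admits an ad-invariant metric if and only if $\mathfrak n_G$ is isomorphic to a direct sum $\mathbb R^s\oplus\mathfrak n_{3,2}\oplus\cdots\oplus\mathfrak n_{3,2}$ of an abelian Lie algebra $\mathbb R^s$ (with $s\ge 0$) and finitely many copies of $\mathfrak n_{3,2}$. Equivalently, $\mathfrak n_G$ admits an ad-invariant metric if and only if each connected component of $G$ is a 3-cycle or an isolated vertex.
   Context: An ad-invariant metric on a real Lie algebra $\mathfrak g$ is a nondegenerate symmetric bilinear form $\langle\cdot,\cdot\rangle:\mathfrak g\times\mathfrak g\to\mathbb R$ (not necessarily positive definite) such that $\langle [X,Y],Z\rangle+\langle Y,[X,Z]\rangle=0$ for all $X,Y,Z\in\mathfrak g$. $G=(V,E)$ is a finite simple graph: $V$ is the finite set of vertices and $E$ is a set of unordered pairs $vw$ of distinct vertices. For $v\in V$, $N(v)=\{w\in V: vw\in E\}$ and $d(v)=|N(v)|$; $v$ is isolated if $d(v)=0$. The Lie algebra $\mathfrak n_G$ is the real vector space $\mathcal V\oplus\mathcal U$, where $\mathcal V$ is the real vector space with basis $V$ and $\mathcal U$ is the subspace of $\Lambda^2\mathcal V$ spanned by $\{v\wedge w: vw\in E\}$. The Lie bracket is the bilinear skew-symmetric extension of: for $v,w\in V$, $[v,w]=v\wedge w$ if $vw\in E$ and $[v,w]=0$ otherwise; and $[x,u]=0$ for all $x\in\mathfrak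 n_G$, $u\in\mathcal U$. $\mathfrak n_{3,2}$ is the real free 2-step nilpotent Lie algebra on 3 generators (of dimension 6). A 3-cycle is the graph $C_3$ with vertices $v_1,v_2,v_3$ and edges $v_1v_2,v_2v_3,v_3v_1$. *)

theory Defs
  imports "HOL-Analysis.Analysis" "HOL-Analysis.Finite_Function_Topology"
begin

section \<open>Real Lie algebras and ad-invariant metrics\<close>

text \<open>
  The underlying vector space of a Lie algebra is a subspace of an ambient type of class
  \<^class>\<open>real_vector\<close>; the value of the bracket outside this subspace is irrelevant.
\<close>

record 'a lie_structure =
  lie_carrier :: "'a set"
  lie_bracket :: "'a \<Rightarrow> 'a \<Rightarrow> 'a"

definition linear_on :: "'a::real_vector set \<Rightarrow> 'b::real_vector set \<Rightarrow> ('a \<Rightarrow> 'b) \<Rightarrow> bool" where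
  "linear_on A B f \<longleftrightarrow>
     f ` A \<subseteq> B \<and>
     (\<forall>x\<in>A. \<forall>y\<in>A. f (x + y) = f x + f y) \<and>
     (\<forall>c. \<forall>x\<in>A. f (c *\<^sub>R x) = c *\<^sub>R f x)"

definition bilinear_on ::
  "'a::real_vector set \<Rightarrow> 'b::real_vector set \<Rightarrow> 'c::real_vector set \<Rightarrow> ('a \<Rightarrow> 'b \<Rightarrow> 'c) \<Rightarrow> bool" where
  "bilinear_on A B C f \<longleftrightarrow>
     (\<forall>x\<in>A. linear_on B C (f x)) \<and> (\<forall>y\<in>B. linear_on A C (\<lambda>x. f x y))"

definition lie_algebra :: "'a::real_vector lie_structure \<Rightarrow> bool" where
  "lie_algebra L \<longleftrightarrow>
     subspace (lie_carrier L) \<and>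
     bilinear_on (lie_carrier L) (lie_carrier L) (lie_carrier L) (lie_bracket L) \<and>
     (\<forall>x\<in>lie_carrier L. lie_bracket L x x = 0) \<and>
     (\<forall>x\<in>lie_carrier L. \<forall>y\<in>lie_carrier L. \<forall>z\<in>lie_carrier L.
        lie_bracket L x (lie_bracket L y z) + lie_bracket L y (lie_bracket L z x)
          + lie_bracket L z (lie_bracket L x y) = 0)"

definition ad_invariant_metric :: "'a::real_vector lie_structure \<Rightarrow> ('a \<Rightarrow> 'a \<Rightarrow> real) \<Rightarrow> bool" where
  "ad_invariant_metric L B \<longleftrightarrow>
     bilinear_on (lie_carrier L) (lie_carrier L) UNIV B \<and>
     (\<forall>x\<in>lie_carrier L. \<forall>y\<in>lie_carrier L. B x y = B y x) \<and>
     (\<forall>x\<in>lie_carrier L. (\<forall>y\<in>lie_carrier L. B x y = 0) \<longrightarrow> x = 0) \<and>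
     (\<forall>x\<in>lie_carrier L. \<forall>y\<in>lie_carrier L. \<forall>z\<in>lie_carrier L.
        B (lie_bracket L x y) z + B y (lie_bracket L x z) = 0)"

definition lie_hom ::
  "'a::real_vector lie_structure \<Rightarrow> 'b::real_vector lie_structure \<Rightarrow> ('a \<Rightarrow> 'b) \<Rightarrow> bool" where
  "lie_hom L M f \<longleftrightarrow>
     linear_on (lie_carrier L) (lie_carrier M) f \<and>
     (\<forall>x\<in>lie_carrier L. \<forall>y\<in>lie_carrier L. f (lie_bracket L x y) = lie_bracket M (f x) (f y))"

definition lie_isomorphic ::
  "'a::real_vector lie_structure \<Rightarrow> 'b::real_vector lie_structure \<Rightarrow> bool" where
  "lie_isomorphic L M \<longleftrightarrow> (\<exists>f. lie_hom L M f \<and> bij_betw f (lie_carrier L) (lie_carrier M))"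

definition two_step_nilpotent :: "'a::real_vector lie_structure \<Rightarrow> bool" where
  \<comment> \<open>of step at most two\<close>
  "two_step_nilpotent L \<longleftrightarrow>
     (\<forall>x\<in>lie_carrier L. \<forall>y\<in>lie_carrier L. \<forall>z\<in>lie_carrier L.
        lie_bracket L x (lie_bracket L y z) = 0)"

definition lie_direct_sum ::
  "'a::real_vector lie_structure \<Rightarrow> 'b::real_vector lie_structure \<Rightarrow> ('a \<times> 'b) lie_structure" where
  "lie_direct_sum L M =
     \<lparr> lie_carrier = lie_carrier L \<times> lie_carrier M,
       lie_bracket = (\<lambda>(x, x') (y, y'). (lie_bracket L x y, lie_bracket M x' y')) \<rparr>"

definition lie_power :: "nat \<Rightarrow> 'a::real_vector lie_structure \<Rightarrow> (nat \<Rightarrow>\<^sub>0 'a) lie_structure" where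
  \<comment> \<open>the direct sum of \<open>k\<close> copies of \<open>L\<close>; \<open>f\<close> stands for the \<open>k\<close>-tuple \<open>f 0, \<dots>, f (k - 1)\<close>\<close>
  "lie_power k L =
     \<lparr> lie_carrier = {f. Poly_Mapping.keys f \<subseteq> {..<k} \<and>
                        (\<forall>i<k. Poly_Mapping.lookup f i \<in> lie_carrier L)},
       lie_bracket = (\<lambda>f g. \<Sum>i<k. Poly_Mapping.single i
          (lie_bracket L (Poly_Mapping.lookup f i) (Poly_Mapping.lookup g i))) \<rparr>"

definition abelian_lie :: "nat \<Rightarrow> (nat \<Rightarrow>\<^sub>0 real) lie_structure" where
  "abelian_lie s =
     \<lparr> lie_carrier = {x. Poly_Mapping.keys x \<subseteq> {..<s}}, lie_bracket = (\<lambda>x y. 0) \<rparr>"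

section \<open>Exterior squares and free 2-step nilpotent Lie algebras\<close>

definition free_space :: "'v set \<Rightarrow> ('v \<Rightarrow>\<^sub>0 real) set" where
  "free_space S = {x. Poly_Mapping.keys x \<subseteq> S}"

abbreviation basis_vec :: "'v \<Rightarrow> ('v \<Rightarrow>\<^sub>0 real)" where
  "basis_vec v \<equiv> Poly_Mapping.single v 1"

text \<open>
  The exterior square of the space with basis \<open>S\<close> is realised inside its tensor square (the space
  with basis \<open>S \<times> S\<close>), with \<open>x \<and> y = x \<otimes> y - y \<otimes> x\<close>: it is the space of skew-symmetric tensors.
\<close>

lift_definition wedge :: "('v \<Rightarrow>\<^sub>0 real) \<Rightarrow> ('v \<Rightarrow>\<^sub>0 real) \<Rightarrow> ('v \<times> 'v \<Rightarrow>\<^sub>0 real)" is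
  "\<lambda>x y (i, j). x i * y j - y i * x j"
proof -
  fix x y :: "'v \<Rightarrow> real"
  assume fin: "finite {i. x i \<noteq> 0}" "finite {i. y i \<noteq> 0}"
  have "{p. (case p of (i, j) \<Rightarrow> x i * y j - y i * x j) \<noteq> 0}
      \<subseteq> {i. x i \<noteq> 0} \<times> {i. y i \<noteq> 0} \<union> {i. y i \<noteq> 0} \<times> {i. x i \<noteq> 0}"
    by auto
  then show "finite {p. (case p of (i, j) \<Rightarrow> x i * y j - y i * x j) \<noteq> 0}"
    by (rule finite_subset) (use fin in auto)
qed

definition free_two_step :: "'v set \<Rightarrow> (('v \<Rightarrow>\<^sub>0 real) \<times> ('v \<times> 'v \<Rightarrow>\<^sub>0 real)) lie_structure" where
  "free_two_step S =
     \<lparr> lie_carrier = free_space S \<times> span {wedge x y | x y. x \<in> free_space S \<and> y \<in> free_space S},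
       lie_bracket = (\<lambda>(x, u) (y, w). (0, wedge x y)) \<rparr>"

definition n32 :: "((nat \<Rightarrow>\<^sub>0 real) \<times> (nat \<times> nat \<Rightarrow>\<^sub>0 real)) lie_structure" where
  "n32 = free_two_step {0, 1, 2}"

section \<open>Graphs and their Lie algebras\<close>

definition finite_simple_graph :: "'v set \<Rightarrow> 'v set set \<Rightarrow> bool" where
  "finite_simple_graph V E \<longleftrightarrow> finite V \<and> E \<subseteq> {{v, w} | v w. v \<in> V \<and> w \<in> V \<and> v \<noteq> w}"

definition neighbours :: "'v set \<Rightarrow> 'v set set \<Rightarrow> 'v \<Rightarrow> 'v set" where
  "neighbours V E v = {w \<in> V. {v, w} \<in> E}"

definition vertex_degree :: "'v set \<Rightarrow> 'v set set \<Rightarrow> 'v \<Rightarrow> nat" where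
  "vertex_degree V E v = card (neighbours V E v)"

definition connected_components_of_graph :: "'v set \<Rightarrow> 'v set set \<Rightarrow> 'v set set" where
  "connected_components_of_graph V E =
     V // {(v, w). v \<in> V \<and> w \<in> V \<and> (v, w) \<in> {(a, b). {a, b} \<in> E}\<^sup>*}"

definition induced_edges :: "'v set set \<Rightarrow> 'v set \<Rightarrow> 'v set set" where
  "induced_edges E C = {e \<in> E. e \<subseteq> C}"

definition is_3_cycle :: "'v set \<Rightarrow> 'v set set \<Rightarrow> bool" where
  "is_3_cycle V E \<longleftrightarrow>
     (\<exists>v1 v2 v3. v1 \<noteq> v2 \<and> v2 \<noteq> v3 \<and> v3 \<noteq> v1 \<and>
        V = {v1, v2, v3} \<and> E = {{v1, v2}, {v2, v3}, {v3, v1}})"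

definition graph_bracket_basis :: "'v set set \<Rightarrow> 'v \<Rightarrow> 'v \<Rightarrow> ('v \<times> 'v \<Rightarrow>\<^sub>0 real)" where
  "graph_bracket_basis E v w = (if {v, w} \<in> E then wedge (basis_vec v) (basis_vec w) else 0)"

definition graph_lie ::
  "'v set \<Rightarrow> 'v set set \<Rightarrow> (('v \<Rightarrow>\<^sub>0 real) \<times> ('v \<times> 'v \<Rightarrow>\<^sub>0 real)) lie_structure" where
  "graph_lie V E =
     \<lparr> lie_carrier =
         free_space V \<times> span {wedge (basis_vec v) (basis_vec w) | v w. {v, w} \<in> E},
       lie_bracket = (\<lambda>(x, u) (y, u').
         (0, \<Sum>v\<in>V. \<Sum>w\<in>V. (Poly_Mapping.lookup x v * Poly_Mapping.lookup y w) *\<^sub>R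
               graph_bracket_basis E v w)) \<rparr>"

section \<open>Basic facts\<close>

lemma lookup_scaleR [simp]:
  "Poly_Mapping.lookup (c *\<^sub>R x) i = c *\<^sub>R Poly_Mapping.lookup x i"
proof -
  have "finite {i. c *\<^sub>R Poly_Mapping.lookup x i \<noteq> 0}"
    by (rule finite_subset[OF _ finite_lookup[of x]]) auto
  then show ?thesis
    by (simp add: scaleR_poly_mapping_def)
qed

lemma lookup_wedge:
  "Poly_Mapping.lookup (wedge x y) (i, j) =
     Poly_Mapping.lookup x i * Poly_Mapping.lookup y j - Poly_Mapping.lookup y i * Poly_Mapping.lookup x j"
  by transfer simp

lemma wedge_simps:
  "wedge (x + x') y = wedge x y + wedge x' y"
  "wedge x (y + y') = wedge x y + wedge x y'"
  "wedge (c *\<^sub>R x) y = c *\<^sub>R wedge x y"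
  "wedge x (c *\<^sub>R y) = c *\<^sub>R wedge x y"
  "wedge x x = 0"
  "wedge x 0 = 0"
  "wedge 0 x = 0"
  by (auto intro!: poly_mapping_eqI simp: lookup_wedge lookup_add algebra_simps)

lemma subspace_free_space: "subspace (free_space S)"
  unfolding subspace_def free_space_def
  by (auto simp: in_keys_iff lookup_add subset_iff) (metis add_0)

lemma lie_algebra_two_step:
  assumes "subspace (lie_carrier L)"
    and "bilinear_on (lie_carrier L) (lie_carrier L) (lie_carrier L) (lie_bracket L)"
    and "\<And>x. x \<in> lie_carrier L \<Longrightarrow> lie_bracket L x x = 0"
    and "two_step_nilpotent L"
  shows "lie_algebra L"
  using assms unfolding lie_algebra_def two_step_nilpotent_def by simp

lemma two_step_free_two_step: "two_step_nilpotent (free_two_step S)"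
  by (auto simp: two_step_nilpotent_def free_two_step_def wedge_simps zero_prod_def)

lemma lie_algebra_free_two_step: "lie_algebra (free_two_step S)"
proof (rule lie_algebra_two_step)
  show "subspace (lie_carrier (free_two_step S))"
    by (simp add: free_two_step_def subspace_Times subspace_free_space)
  show "bilinear_on (lie_carrier (free_two_step S)) (lie_carrier (free_two_step S))
          (lie_carrier (free_two_step S)) (lie_bracket (free_two_step S))"
    using subspace_0[OF subspace_free_space[of S]]
    by (auto simp: bilinear_on_def linear_on_def free_two_step_def wedge_simps intro: span_base)
  show "lie_bracket (free_two_step S) x x = 0" for x
    by (auto simp: free_two_step_def wedge_simps zero_prod_def split: prod.split)
qed (rule two_step_free_two_step)

lemma two_step_graph_lie: "two_step_nilpotent (graph_lie V E)"
  by (auto simp: two_step_nilpotent_def graph_lie_def zero_prod_def)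

lemma lie_algebra_graph_lie: "lie_algebra (graph_lie V E)"
proof (rule lie_algebra_two_step)
  show "subspace (lie_carrier (graph_lie V E))"
    by (simp add: graph_lie_def subspace_Times subspace_free_space)
  have gb: "graph_bracket_basis E v w \<in> span {wedge (basis_vec v) (basis_vec w) | v w. {v, w} \<in> E}"
    for v w
    by (auto simp: graph_bracket_basis_def span_zero intro!: span_base)
  show "bilinear_on (lie_carrier (graph_lie V E)) (lie_carrier (graph_lie V E))
          (lie_carrier (graph_lie V E)) (lie_bracket (graph_lie V E))"
    using subspace_0[OF subspace_free_space[of V]] gb
    by (auto simp: bilinear_on_def linear_on_def graph_lie_def lookup_add
        algebra_simps sum.distrib scaleR_sum_right intro!: span_sum span_scale)
  show "lie_bracket (graph_lie V E) p p = 0" for p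
  proof -
    obtain x u where p: "p = (x, u)" by (cases p)
    define S where "S = (\<Sum>v\<in>V. \<Sum>w\<in>V.
      (Poly_Mapping.lookup x v * Poly_Mapping.lookup x w) *\<^sub>R graph_bracket_basis E v w)"
    have anti: "graph_bracket_basis E w v = - graph_bracket_basis E v w" for v w
      by (auto intro!: poly_mapping_eqI
          simp: graph_bracket_basis_def lookup_wedge insert_commute)
    have "S = (\<Sum>w\<in>V. \<Sum>v\<in>V.
      (Poly_Mapping.lookup x v * Poly_Mapping.lookup x w) *\<^sub>R graph_bracket_basis E v w)"
      unfolding S_def by (rule sum.swap)
    also have "\<dots> = - S"
      unfolding S_def sum_negf[symmetric]
      by (intro sum.cong refl) (subst anti, simp add: mult.commute)
    finally have "2 *\<^sub>R S = 0"
      by (simp add: scaleR_2 eq_neg_iff_add_eq_0)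
    then have "S = 0"
      by simp
    then show ?thesis
      by (simp add: p graph_lie_def S_def zero_prod_def)
  qed
qed (rule two_step_graph_lie)

lemma graph_lie_bracket_basis:
  assumes "finite V" "v \<in> V" "w \<in> V"
  shows "lie_bracket (graph_lie V E) (basis_vec v, 0) (basis_vec w, 0) =
           (0, if {v, w} \<in> E then wedge (basis_vec v) (basis_vec w) else 0)"
proof -
  have "(\<Sum>a\<in>V. \<Sum>b\<in>V. (Poly_Mapping.lookup (basis_vec v) a * Poly_Mapping.lookup (basis_vec w) b)
           *\<^sub>R graph_bracket_basis E a b)
      = (\<Sum>a\<in>V. if a = v then \<Sum>b\<in>V. if b = w then graph_bracket_basis E a b else 0 else 0)"
    by (intro sum.cong refl) (auto simp: lookup_single when_def intro!: sum.cong)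
  then show ?thesis
    using assms by (simp add: graph_lie_def graph_bracket_basis_def)
qed

lemma lie_algebra_abelian_lie: "lie_algebra (abelian_lie s)"
proof (rule lie_algebra_two_step)
  show "subspace (lie_carrier (abelian_lie s))"
    using subspace_free_space[of "{..<s}"] by (simp add: abelian_lie_def free_space_def)
qed (auto simp: abelian_lie_def bilinear_on_def linear_on_def two_step_nilpotent_def)

lemma lie_algebra_direct_sum:
  assumes "lie_algebra L" "lie_algebra M"
  shows "lie_algebra (lie_direct_sum L M)"
  using assms
  by (auto simp: lie_algebra_def lie_direct_sum_def subspace_Times bilinear_on_def linear_on_def
      image_subset_iff zero_prod_def)

lemma lookup_lie_power_bracket:
  "Poly_Mapping.lookup (lie_bracket (lie_power k L) f g) i =
     (if i < k then lie_bracket L (Poly_Mapping.lookup f i) (Poly_Mapping.lookup g i) else 0)"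
  by (simp add: lie_power_def lookup_sum lookup_single when_def)

lemma lie_power_carrier_iff:
  assumes "subspace (lie_carrier L)"
  shows "f \<in> lie_carrier (lie_power k L) \<longleftrightarrow>
    (\<forall>i. Poly_Mapping.lookup f i \<in> lie_carrier L \<and> (i \<ge> k \<longrightarrow> Poly_Mapping.lookup f i = 0))"
  using subspace_0[OF assms]
  by (auto simp: lie_power_def subset_iff in_keys_iff) (metis leI)+

lemma lie_algebra_power:
  assumes L: "lie_algebra L"
  shows "lie_algebra (lie_power k L)"
proof -
  have sub: "subspace (lie_carrier L)" and alt: "\<And>x. x \<in> lie_carrier L \<Longrightarrow> lie_bracket L x x = 0"
    using L by (auto simp: lie_algebra_def)
  note [simp] = lie_power_carrier_iff[OF sub] lookup_lie_power_bracket
  have "subspace (lie_carrier (lie_power k L))"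
    using sub unfolding subspace_def[of "lie_carrier (lie_power k L)"]
    by (auto simp: lookup_add subspace_0 subspace_add subspace_scale)
  moreover have "bilinear_on (lie_carrier (lie_power k L)) (lie_carrier (lie_power k L))
      (lie_carrier (lie_power k L)) (lie_bracket (lie_power k L))"
    using L subspace_0[OF sub]
    unfolding lie_algebra_def bilinear_on_def linear_on_def image_subset_iff
    by (auto intro!: poly_mapping_eqI simp: lookup_add)
  moreover have "\<forall>x\<in>lie_carrier (lie_power k L). lie_bracket (lie_power k L) x x = 0"
    using alt by (auto intro!: poly_mapping_eqI)
  moreover have "\<forall>x\<in>lie_carrier (lie_power k L). \<forall>y\<in>lie_carrier (lie_power k L).
      \<forall>z\<in>lie_carrier (lie_power k L).
        lie_bracket (lie_power k L) x (lie_bracket (lie_power k L) y z)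
          + lie_bracket (lie_power k L) y (lie_bracket (lie_power k L) z x)
          + lie_bracket (lie_power k L) z (lie_bracket (lie_power k L) x y) = 0"
    using L unfolding lie_algebra_def by (auto intro!: poly_mapping_eqI simp: lookup_add)
  ultimately show ?thesis
    by (simp add: lie_algebra_def)
qed

text \<open>The universal property justifying the name \<open>free_two_step\<close>.\<close>

lemma free_space_expand:
  assumes "finite S" "x \<in> free_space S"
  shows "x = (\<Sum>v\<in>S. Poly_Mapping.lookup x v *\<^sub>R basis_vec v)"
proof (rule poly_mapping_eqI)
  fix i
  show "Poly_Mapping.lookup x i = Poly_Mapping.lookup (\<Sum>v\<in>S. Poly_Mapping.lookup x v *\<^sub>R basis_vec v) i"
    using assms
    by (auto simp: lookup_sum lookup_single when_def free_space_def subset_iff in_keys_iff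
        if_distrib cong: if_cong)
qed

lemma linear_on_sum:
  assumes f: "linear_on A B f" and A: "subspace A" and g: "\<And>i. i \<in> I \<Longrightarrow> g i \<in> A"
  shows "f (\<Sum>i\<in>I. c i *\<^sub>R g i) = (\<Sum>i\<in>I. c i *\<^sub>R f (g i))"
proof -
  have "f 0 = 0"
    using f subspace_0[OF A] unfolding linear_on_def by (metis scaleR_zero_left)
  then show ?thesis
    using g
  proof (induction I rule: infinite_finite_induct)
    case (insert i I)
    have "(\<Sum>j\<in>I. c j *\<^sub>R g j) \<in> A" "c i *\<^sub>R g i \<in> A"
      using insert.prems by (auto intro!: subspace_sum[OF A] subspace_scale[OF A])
    then show ?case
      using insert f by (simp add: linear_on_def)
  qed auto
qed

lemma free_two_step_universal:
  fixes M :: "'b::real_vector lie_structure"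
  assumes S: "finite S" and M: "lie_algebra M" "two_step_nilpotent M"
    and f: "\<And>v. v \<in> S \<Longrightarrow> f v \<in> lie_carrier M"
  shows "\<exists>\<phi>. lie_hom (free_two_step S) M \<phi> \<and> (\<forall>v\<in>S. \<phi> (basis_vec v, 0) = f v)"
    and "\<lbrakk>lie_hom (free_two_step S) M \<phi>; lie_hom (free_two_step S) M \<psi>;
           \<And>v. v \<in> S \<Longrightarrow> \<phi> (basis_vec v, 0) = \<psi> (basis_vec v, 0); p \<in> lie_carrier (free_two_step S)\<rbrakk>
         \<Longrightarrow> \<phi> p = \<psi> p"
proof -
  let ?L = "free_two_step S" and ?M = "lie_carrier M" and ?b = "lie_bracket M"
  let ?l = Poly_Mapping.lookup
  have sub: "subspace ?M" and bil: "bilinear_on ?M ?M ?M ?b" and alt: "\<And>x. x \<in> ?M \<Longrightarrow> ?b x x = 0"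
    using M by (auto simp: lie_algebra_def)
  have bM: "?b x y \<in> ?M" if "x \<in> ?M" "y \<in> ?M" for x y
    using bil that unfolding bilinear_on_def linear_on_def by blast
  have bl: "linear_on ?M ?M (?b x)" "linear_on ?M ?M (\<lambda>y. ?b y x)" if "x \<in> ?M" for x
    using bil that by (auto simp: bilinear_on_def)
  have anti: "?b y x = - ?b x y" if "x \<in> ?M" "y \<in> ?M" for x y
  proof -
    have xy: "x + y \<in> ?M" using that sub by (simp add: subspace_add)
    have "0 = ?b (x + y) (x + y)" using alt[OF xy] by simp
    also have "\<dots> = ?b x (x + y) + ?b y (x + y)"
      using bl(2)[OF xy] that by (auto simp: linear_on_def)
    also have "\<dots> = ?b x y + ?b y x"
      using bl(1) that alt by (auto simp: linear_on_def)
    finally show ?thesis by (metis add.commute eq_neg_iff_add_eq_0)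
  qed
  define \<alpha> where "\<alpha> x = (\<Sum>v\<in>S. ?l x v *\<^sub>R f v)" for x
  define \<beta> where "\<beta> u = (1/2) *\<^sub>R (\<Sum>v\<in>S. \<Sum>w\<in>S. ?l u (v, w) *\<^sub>R ?b (f v) (f w))" for u
  have \<alpha>M: "\<alpha> x \<in> ?M" for x
    unfolding \<alpha>_def by (intro subspace_sum[OF sub] subspace_scale[OF sub] f)
  have \<beta>M: "\<beta> u \<in> ?M" for u
    unfolding \<beta>_def by (intro subspace_sum[OF sub] subspace_scale[OF sub] bM f)
  have \<alpha>lin: "\<alpha> (x + y) = \<alpha> x + \<alpha> y" "\<alpha> (c *\<^sub>R x) = c *\<^sub>R \<alpha> x" for x y c
    by (auto simp: \<alpha>_def lookup_add scaleR_add_left sum.distrib scaleR_sum_right)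
  have \<beta>lin: "\<beta> (x + y) = \<beta> x + \<beta> y" "\<beta> (c *\<^sub>R x) = c *\<^sub>R \<beta> x" for x y c
    by (auto simp: \<beta>_def lookup_add scaleR_add_left sum.distrib scaleR_sum_right algebra_simps)
  have cz: "?b x (\<beta> u) = 0" if "x \<in> ?M" for x u
  proof -
    have "?b x (\<beta> u) = ?b x (\<Sum>q\<in>S\<times>S. ((1/2) * ?l u q) *\<^sub>R ?b (f (fst q)) (f (snd q)))"
      unfolding \<beta>_def by (simp add: sum.cartesian_product case_prod_beta scaleR_sum_right)
    also have "\<dots> = (\<Sum>q\<in>S\<times>S. ((1/2) * ?l u q) *\<^sub>R ?b x (?b (f (fst q)) (f (snd q))))"
      by (rule linear_on_sum[OF bl(1)[OF that] sub]) (auto intro!: bM f)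
    also have "\<dots> = 0"
      using M(2) that f by (intro sum.neutral) (auto simp: two_step_nilpotent_def)
    finally show ?thesis .
  qed
  have cz': "?b (\<beta> u) x = 0" if "x \<in> ?M" for x u
    using anti[OF that \<beta>M] cz[OF that] by simp
  have \<alpha>b: "?b (\<alpha> x) (\<alpha> y) = (\<Sum>v\<in>S. \<Sum>w\<in>S. (?l x v * ?l y w) *\<^sub>R ?b (f v) (f w))" for x y
  proof -
    have "?b (\<alpha> x) (\<alpha> y) = (\<Sum>v\<in>S. ?l x v *\<^sub>R ?b (f v) (\<alpha> y))"
      unfolding \<alpha>_def[of x] by (rule linear_on_sum[OF bl(2)[OF \<alpha>M] sub f])
    also have "\<dots> = (\<Sum>v\<in>S. ?l x v *\<^sub>R (\<Sum>w\<in>S. ?l y w *\<^sub>R ?b (f v) (f w)))"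
      unfolding \<alpha>_def
      by (rule sum.cong[OF refl], rule arg_cong[where f = "scaleR _"],
          rule linear_on_sum[OF bl(1)[OF f] sub f])
    finally show ?thesis by (simp add: scaleR_sum_right)
  qed
  have \<beta>w: "\<beta> (wedge x y) = ?b (\<alpha> x) (\<alpha> y)" for x y
  proof -
    have "(\<Sum>v\<in>S. \<Sum>w\<in>S. ?l (wedge x y) (v, w) *\<^sub>R ?b (f v) (f w)) = ?b (\<alpha> x) (\<alpha> y) - ?b (\<alpha> y) (\<alpha> x)"
      by (simp add: \<alpha>b lookup_wedge scaleR_diff_left sum_subtractf)
    also have "\<dots> = 2 *\<^sub>R ?b (\<alpha> x) (\<alpha> y)"
      using anti[OF \<alpha>M \<alpha>M, of x y] by (simp add: scaleR_2)
    finally show ?thesis by (simp add: \<beta>_def)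
  qed
  define \<phi>0 where "\<phi>0 = (\<lambda>(x, u). \<alpha> x + \<beta> u)"
  have "lie_hom ?L M \<phi>0"
    unfolding lie_hom_def
  proof (intro conjI ballI)
    show "linear_on (lie_carrier ?L) ?M \<phi>0"
      by (auto simp: linear_on_def \<phi>0_def \<alpha>lin \<beta>lin subspace_add[OF sub] \<alpha>M \<beta>M scaleR_add_right)
  next
    fix p q assume "p \<in> lie_carrier ?L" "q \<in> lie_carrier ?L"
    obtain x u y w where pq: "p = (x, u)" "q = (y, w)" by (cases p, cases q)
    have \<alpha>0: "\<alpha> 0 = 0" by (simp add: \<alpha>_def)
    have m: "\<alpha> y + \<beta> w \<in> ?M" by (intro subspace_add[OF sub] \<alpha>M \<beta>M)
    have "?b (\<alpha> x + \<beta> u) (\<alpha> y + \<beta> w) = ?b (\<alpha> x) (\<alpha> y + \<beta> w) + ?b (\<beta> u) (\<alpha> y + \<beta> w)"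
      using bl(2)[OF m] \<alpha>M \<beta>M by (simp add: linear_on_def)
    also have "\<dots> = ?b (\<alpha> x) (\<alpha> y)"
      using bl(1)[OF \<alpha>M[of x]] \<alpha>M \<beta>M cz cz' m by (simp add: linear_on_def)
    finally show "\<phi>0 (lie_bracket ?L p q) = ?b (\<phi>0 p) (\<phi>0 q)"
      by (simp add: pq \<phi>0_def free_two_step_def \<beta>w \<alpha>0)
  qed
  moreover have "\<phi>0 (basis_vec v, 0) = f v" if "v \<in> S" for v
  proof -
    have "\<alpha> (basis_vec v) = (\<Sum>w\<in>S. if w = v then f w else 0)"
      unfolding \<alpha>_def by (intro sum.cong refl) (auto simp: lookup_single when_def)
    then show ?thesis using S that by (simp add: \<phi>0_def \<beta>_def)
  qed
  ultimately show "\<exists>\<phi>. lie_hom ?L M \<phi> \<and> (\<forall>v\<in>S. \<phi> (basis_vec v, 0) = f v)"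
    by blast

  assume h: "lie_hom ?L M \<phi>" "lie_hom ?L M \<psi>"
    and eq: "\<And>v. v \<in> S \<Longrightarrow> \<phi> (basis_vec v, 0) = \<psi> (basis_vec v, 0)" and p: "p \<in> lie_carrier ?L"
  have subL: "subspace (lie_carrier ?L)"
    using lie_algebra_free_two_step[of S] by (simp add: lie_algebra_def)
  have lin: "linear_on (lie_carrier ?L) ?M \<phi>" "linear_on (lie_carrier ?L) ?M \<psi>"
    using h by (auto simp: lie_hom_def)
  have add: "\<phi> (p + q) = \<phi> p + \<phi> q" "\<psi> (p + q) = \<psi> p + \<psi> q"
    if "p \<in> lie_carrier ?L" "q \<in> lie_carrier ?L" for p q
    using lin that unfolding linear_on_def by blast+
  have scale: "\<phi> (c *\<^sub>R p) = c *\<^sub>R \<phi> p" "\<psi> (c *\<^sub>R p) = c *\<^sub>R \<psi> p"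
    if "p \<in> lie_carrier ?L" for p c
    using lin that unfolding linear_on_def by blast+
  let ?W = "{wedge x y | x y. x \<in> free_space S \<and> y \<in> free_space S}"
  have V: "(x, 0) \<in> lie_carrier ?L" if "x \<in> free_space S" for x
    using that by (simp add: free_two_step_def span_zero)
  have U: "(0, u) \<in> lie_carrier ?L" if "u \<in> span ?W" for u
    using that subspace_0[OF subspace_free_space[of S]] by (simp add: free_two_step_def)
  have bas: "basis_vec v \<in> free_space S" if "v \<in> S" for v
    using that by (simp add: free_space_def)
  have eqV: "\<phi> (x, 0) = \<psi> (x, 0)" if x: "x \<in> free_space S" for x
  proof -
    have e: "(x, 0) = (\<Sum>v\<in>S. ?l x v *\<^sub>R (basis_vec v, 0 :: 'a \<times> 'a \<Rightarrow>\<^sub>0 real))"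
      by (subst free_space_expand[OF S x]) (simp add: sum_prod)
    show ?thesis
      unfolding e
      by (subst linear_on_sum[OF lin(1) subL], use V bas in blast)
         (subst linear_on_sum[OF lin(2) subL], use V bas eq in auto)
  qed
  have "(0, u) \<in> lie_carrier ?L \<and> \<phi> (0, u) = \<psi> (0, u)" if "u \<in> span ?W" for u
    using that
  proof (induction rule: span_induct_alt)
    case base
    show ?case using eqV V subspace_0[OF subspace_free_space[of S]] by simp
  next
    case (step c w u)
    then obtain x y where w: "w = wedge x y" "x \<in> free_space S" "y \<in> free_space S" by blast
    have wb: "(0, w) = lie_bracket ?L (x, 0) (y, 0)" by (simp add: w free_two_step_def)
    have weq: "\<phi> (0, w) = \<psi> (0, w)"
      unfolding wb using h V w eqV by (simp add: lie_hom_def)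
    have wL: "(0, w) \<in> lie_carrier ?L" using step(1) by (intro U span_base)
    have cL: "c *\<^sub>R (0, w) \<in> lie_carrier ?L" by (rule subspace_scale[OF subL wL])
    have uL: "(0, u) \<in> lie_carrier ?L" and ueq: "\<phi> (0, u) = \<psi> (0, u)"
      using step(2) by auto
    have e: "(0, c *\<^sub>R w + u) = c *\<^sub>R (0, w) + (0, u)" by simp
    have "\<phi> (c *\<^sub>R (0, w) + (0, u)) = \<psi> (c *\<^sub>R (0, w) + (0, u))"
      unfolding add[OF cL uL] scale[OF wL] weq ueq ..
    then show ?case
      unfolding e using subspace_add[OF subL cL uL] by blast
  qed
  then have eqU: "\<phi> (0, u) = \<psi> (0, u)" if "u \<in> span ?W" for u
    using that by blast
  obtain x u where xu: "p = (x, u)" by (cases p)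
  have x: "x \<in> free_space S" and u: "u \<in> span ?W"
    using p by (auto simp: xu free_two_step_def)
  have "\<phi> ((x, 0) + (0, u)) = \<psi> ((x, 0) + (0, u))"
    unfolding add[OF V[OF x] U[OF u]] eqV[OF x] eqU[OF u] ..
  then show "\<phi> p = \<psi> p" by (simp add: xu)
qed

end

theory Submission
  imports Defs
begin

text \<open>
  If \<open>\<langle>\<cdot>,\<cdot>\<rangle>\<close> is an ad-invariant metric on the Lie algebra of a graph, \<open>\<langle>[v, w], z\<rangle>\<close> is
  alternating in the vertices \<open>v\<close>, \<open>w\<close>, \<open>z\<close>, hence vanishes unless they form a triangle.
  An element of \<open>\<U>\<close> is orthogonal to \<open>\<U>\<close> and to the isolated vertices, so by nondegeneracy the
  functionals \<open>\<langle>[v, w], \<cdot>\<rangle>\<close>, one for each edge \<open>vw\<close>, are linearly independent on the span of the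
  non-isolated vertices. Thus each edge lies in a triangle, so non-isolated vertices have degree at
  least 2, while there are at most as many edges as non-isolated vertices. By the handshake
  lemma all these degrees are exactly 2, and the components are triangles and points.
\<close>

section \<open>Metrics on the model algebras\<close>

text \<open>Both equivalences come from one cycle of implications: a metric gives the condition on
  components, this gives the direct sum, and the direct sum carries a metric. The graph therefore
  never has to be recovered from an abstract isomorphism. The set of non-isolated vertices is
  written \<open>\<Union>E\<close> throughout. Since the metric may be indefinite, the isotropy of
  the derived part is no contradiction; it only forces that part to be paired with the vertices. The
  number three enters here: a triangle has as many edges as corners, so each \<open>n32\<close>
  pairs its three generators with its three brackets. On \<open>n32\<close> such a pairing exists
  because the exterior square of a 3-dimensional space is dual to the space, by the determinant,
  which is invariant because it alternates. Once all non-isolated vertices have degree 2, a triangle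
  has no room for a further neighbour, so it is a whole component.\<close>

text \<open>Nondegeneracy uses both halves of bijectivity: by surjectivity the images of
  \<open>L\<close> are enough test vectors in \<open>M\<close>, and by injectivity
  \<open>f x = 0\<close> gives \<open>x = 0\<close>.\<close>

lemma ad_invariant_metric_pullback:
  assumes "lie_isomorphic L M" "lie_algebra L" "ad_invariant_metric M B"
  shows "\<exists>B'. ad_invariant_metric L B'"
proof -
  obtain f where f: "lie_hom L M f" and bij: "bij_betw f (lie_carrier L) (lie_carrier M)"
    using assms(1) by (auto simp: lie_isomorphic_def)
  have im: "f ` lie_carrier L = lie_carrier M" and inj: "inj_on f (lie_carrier L)"
    using bij by (auto simp: bij_betw_def)
  have fM: "f x \<in> lie_carrier M" if "x \<in> lie_carrier L" for x
    using im that by blast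
  have lin: "linear_on (lie_carrier L) (lie_carrier M) f"
    and br: "\<And>x y. x \<in> lie_carrier L \<Longrightarrow> y \<in> lie_carrier L \<Longrightarrow>
      f (lie_bracket L x y) = lie_bracket M (f x) (f y)"
    using f by (auto simp: lie_hom_def)
  have 0: "0 \<in> lie_carrier L"
    using assms(2) by (simp add: lie_algebra_def subspace_0)
  have f0: "f 0 = 0"
    using lin 0 unfolding linear_on_def by (metis scaleR_zero_left)
  have B: "bilinear_on (lie_carrier M) (lie_carrier M) UNIV B"
    "\<forall>x\<in>lie_carrier M. \<forall>y\<in>lie_carrier M. B x y = B y x"
    "\<forall>x\<in>lie_carrier M. (\<forall>y\<in>lie_carrier M. B x y = 0) \<longrightarrow> x = 0"
    "\<forall>x\<in>lie_carrier M. \<forall>y\<in>lie_carrier M. \<forall>z\<in>lie_carrier M.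
        B (lie_bracket M x y) z + B y (lie_bracket M x z) = 0"
    using assms(3) by (auto simp: ad_invariant_metric_def)
  have "ad_invariant_metric L (\<lambda>x y. B (f x) (f y))"
    unfolding ad_invariant_metric_def
  proof (intro conjI ballI impI)
    show "bilinear_on (lie_carrier L) (lie_carrier L) UNIV (\<lambda>x y. B (f x) (f y))"
      using B(1) lin fM by (auto simp: bilinear_on_def linear_on_def)
  next
    fix x assume x: "x \<in> lie_carrier L" "\<forall>y\<in>lie_carrier L. B (f x) (f y) = 0"
    then have "f x = 0"
      using B(3) fM unfolding im[symmetric] by blast
    then show "x = 0"
      using inj x(1) 0 f0 by (metis inj_onD)
  qed (use B br fM in auto)
  then show ?thesis by blast
qed

text \<open>This is the orthogonal sum of the two forms. Nondegeneracy separates into the summands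
  by testing against pairs with one component zero.\<close>

lemma ad_invariant_metric_direct_sum:
  assumes L: "lie_algebra L" "ad_invariant_metric L B"
    and M: "lie_algebra M" "ad_invariant_metric M C"
  shows "ad_invariant_metric (lie_direct_sum L M) (\<lambda>(x, x') (y, y'). B x y + C x' y')"
proof -
  have 0: "0 \<in> lie_carrier L" "0 \<in> lie_carrier M"
    using L(1) M(1) by (auto simp: lie_algebra_def subspace_0)
  have z: "B x 0 = 0" "C y 0 = 0" if "x \<in> lie_carrier L" "y \<in> lie_carrier M" for x y
    using L(2) M(2) 0 that unfolding ad_invariant_metric_def bilinear_on_def linear_on_def
    by (metis scaleR_zero_left)+
  have nd: "x = 0 \<and> y = 0" if xy: "x \<in> lie_carrier L" "y \<in> lie_carrier M"
    and h: "\<forall>x'\<in>lie_carrier L. \<forall>y'\<in>lie_carrier M. B x x' + C y y' = 0" for x y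
  proof -
    have "B x x' = 0" if "x' \<in> lie_carrier L" for x'
      using h 0 that z[OF xy] by fastforce
    moreover have "C y y' = 0" if "y' \<in> lie_carrier M" for y'
      using h 0 that z[OF xy] by fastforce
    ultimately show ?thesis
      using L(2) M(2) xy by (auto simp: ad_invariant_metric_def)
  qed
  have inv: "B (lie_bracket L x y) z + C (lie_bracket M x' y') z'
      + (B y (lie_bracket L x z) + C y' (lie_bracket M x' z')) = 0"
    if "x \<in> lie_carrier L" "y \<in> lie_carrier L" "z \<in> lie_carrier L"
      "x' \<in> lie_carrier M" "y' \<in> lie_carrier M" "z' \<in> lie_carrier M" for x y z x' y' z'
  proof -
    have "B (lie_bracket L x y) z + B y (lie_bracket L x z) = 0"
      "C (lie_bracket M x' y') z' + C y' (lie_bracket M x' z') = 0"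
      using L(2) M(2) that by (auto simp: ad_invariant_metric_def)
    then show ?thesis by linarith
  qed
  have bil: "bilinear_on (lie_carrier L) (lie_carrier L) UNIV B"
     "bilinear_on (lie_carrier M) (lie_carrier M) UNIV C"
    and sym: "\<forall>x\<in>lie_carrier L. \<forall>y\<in>lie_carrier L. B x y = B y x"
     "\<forall>x\<in>lie_carrier M. \<forall>y\<in>lie_carrier M. C x y = C y x"
    using L(2) M(2) by (auto simp: ad_invariant_metric_def)
  show ?thesis
    unfolding ad_invariant_metric_def lie_direct_sum_def
  proof (intro conjI)
    show "bilinear_on (lie_carrier \<lparr>lie_carrier = lie_carrier L \<times> lie_carrier M,
        lie_bracket = \<lambda>(x, x') (y, y'). (lie_bracket L x y, lie_bracket M x' y')\<rparr>)
      (lie_carrier \<lparr>lie_carrier = lie_carrier L \<times> lie_carrier M,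
        lie_bracket = \<lambda>(x, x') (y, y'). (lie_bracket L x y, lie_bracket M x' y')\<rparr>)
      UNIV (\<lambda>(x, x') (y, y'). B x y + C x' y')"
      using bil by (auto simp: bilinear_on_def linear_on_def algebra_simps)
  qed (use sym nd inv in \<open>auto simp: zero_prod_def\<close>)
qed

lemma ad_invariant_metric_power:
  assumes L: "lie_algebra L" "ad_invariant_metric L B"
  shows "ad_invariant_metric (lie_power k L)
    (\<lambda>f g. \<Sum>i<k. B (Poly_Mapping.lookup f i) (Poly_Mapping.lookup g i))"
proof -
  have sub: "subspace (lie_carrier L)"
    using L(1) by (auto simp: lie_algebra_def)
  note 0 = subspace_0[OF sub]
  note [simp] = lie_power_carrier_iff[OF sub] lookup_lie_power_bracket
  have bil: "bilinear_on (lie_carrier L) (lie_carrier L) UNIV B"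
    and sym: "\<forall>x\<in>lie_carrier L. \<forall>y\<in>lie_carrier L. B x y = B y x"
    and nd: "\<And>x. x\<in>lie_carrier L \<Longrightarrow> (\<forall>y\<in>lie_carrier L. B x y = 0) \<Longrightarrow> x = 0"
    and inv: "\<forall>x\<in>lie_carrier L. \<forall>y\<in>lie_carrier L. \<forall>z\<in>lie_carrier L.
        B (lie_bracket L x y) z + B y (lie_bracket L x z) = 0"
    using L(2) by (auto simp: ad_invariant_metric_def)
  have z: "B x 0 = 0" if "x \<in> lie_carrier L" for x
    using bil 0 that unfolding bilinear_on_def linear_on_def by (metis scaleR_zero_left)
  show ?thesis
    unfolding ad_invariant_metric_def
  proof (intro conjI ballI impI)
    show "bilinear_on (lie_carrier (lie_power k L)) (lie_carrier (lie_power k L)) UNIV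
      (\<lambda>f g. \<Sum>i<k. B (Poly_Mapping.lookup f i) (Poly_Mapping.lookup g i))"
      using bil by (auto simp: bilinear_on_def linear_on_def lookup_add sum.distrib sum_distrib_left)
  next
    fix f g assume "f \<in> lie_carrier (lie_power k L)" "g \<in> lie_carrier (lie_power k L)"
    then show "(\<Sum>i<k. B (Poly_Mapping.lookup f i) (Poly_Mapping.lookup g i)) =
      (\<Sum>i<k. B (Poly_Mapping.lookup g i) (Poly_Mapping.lookup f i))"
      using sym by (intro sum.cong refl) auto
  next
    fix f assume f: "f \<in> lie_carrier (lie_power k L)"
      and h: "\<forall>g\<in>lie_carrier (lie_power k L).
        (\<Sum>i<k. B (Poly_Mapping.lookup f i) (Poly_Mapping.lookup g i)) = 0"
    show "f = 0"
    proof (rule poly_mapping_eqI)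
      fix i
      show "Poly_Mapping.lookup f i = Poly_Mapping.lookup 0 i"
      proof (cases "i < k")
        case True
        have "B (Poly_Mapping.lookup f i) y = 0" if y: "y \<in> lie_carrier L" for y
        proof -
          \<comment> \<open>The tuple with the single entry \<open>y\<close> at place
            \<open>i\<close> isolates the \<open>i\<close>-th term of the orthogonal sum.\<close>
          have "Poly_Mapping.single i y \<in> lie_carrier (lie_power k L)"
            using y True 0 by (auto simp: lookup_single when_def)
          then have "0 = (\<Sum>j<k. B (Poly_Mapping.lookup f j) (Poly_Mapping.lookup (Poly_Mapping.single i y) j))"
            using h by auto
          also have "\<dots> = (\<Sum>j<k. if j = i then B (Poly_Mapping.lookup f j) y else 0)"
            using f z by (intro sum.cong refl) (auto simp: lookup_single when_def)
          finally show ?thesis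
            using True by simp
        qed
        then show ?thesis
          using nd f by auto
      qed (use f in auto)
    qed
  next
    fix f g h assume "f \<in> lie_carrier (lie_power k L)" "g \<in> lie_carrier (lie_power k L)"
      "h \<in> lie_carrier (lie_power k L)"
    then show "(\<Sum>i<k. B (Poly_Mapping.lookup (lie_bracket (lie_power k L) f g) i) (Poly_Mapping.lookup h i)) +
       (\<Sum>i<k. B (Poly_Mapping.lookup g i) (Poly_Mapping.lookup (lie_bracket (lie_power k L) f h) i)) = 0"
      using inv unfolding sum.distrib[symmetric] by (intro sum.neutral) auto
  qed
qed

lemma ad_invariant_metric_abelian:
  "ad_invariant_metric (abelian_lie s)
    (\<lambda>x y. \<Sum>i<s. Poly_Mapping.lookup x i * Poly_Mapping.lookup y i)"
proof -
  have "x = 0" if x: "Poly_Mapping.keys x \<subseteq> {..<s}"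
    and h: "\<forall>y. Poly_Mapping.keys y \<subseteq> {..<s} \<longrightarrow>
      (\<Sum>i<s. Poly_Mapping.lookup x i * Poly_Mapping.lookup y i) = 0" for x :: "nat \<Rightarrow>\<^sub>0 real"
  proof -
    \<comment> \<open>The form is the standard inner product, so pairing \<open>x\<close> with
      itself already detects whether it is zero.\<close>
    have "(\<Sum>i<s. Poly_Mapping.lookup x i * Poly_Mapping.lookup x i) = 0"
      using x h by blast
    then have "\<forall>i<s. Poly_Mapping.lookup x i = 0"
      by (simp add: sum_nonneg_eq_0_iff)
    then show "x = 0"
      using x by (intro poly_mapping_eqI) (auto simp: subset_iff in_keys_iff)
  qed
  then show ?thesis
    by (auto simp: ad_invariant_metric_def abelian_lie_def bilinear_on_def linear_on_def lookup_add
        algebra_simps sum.distrib sum_distrib_left)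
qed

section \<open>Coordinates on exterior squares\<close>

text \<open>The coefficient is a difference of two indicators comparing whole pairs, so that later
  sums over pairs or edges collapse to single terms. For \<open>v = w\<close> the indicators cancel,
  in agreement with the vanishing wedge.\<close>

lemma lookup_scaleR_wedge_basis:
  "Poly_Mapping.lookup (c *\<^sub>R wedge (basis_vec v) (basis_vec w)) q =
    (if (v, w) = q then c else 0) - (if (v, w) = prod.swap q then c else 0)"
proof -
  obtain a b where q: "q = (a, b)" by (cases q)
  have "Poly_Mapping.lookup (c *\<^sub>R wedge (basis_vec v) (basis_vec w)) q =
      c * ((if (v, w) = q then 1 else 0) - (if (v, w) = prod.swap q then 1 else 0))"
    unfolding q lookup_scaleR real_scaleR_def lookup_wedge lookup_single when_def prod.inject swap_simp
    by (cases "v = a"; cases "w = b"; cases "v = b"; cases "w = a") simp_all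
  moreover have "c * ((if P then 1 else 0) - (if Q then 1 else 0)) =
      (if P then c else 0) - (if Q then c else 0)" for P Q
    by simp
  ultimately show ?thesis
    by (rule trans)
qed

lemmas lookup_wedge_basis = lookup_scaleR_wedge_basis[of 1, unfolded scaleR_one]

text \<open>The factor 1/2 appears because the support contains each pair in both orders, and both
  orders contribute the same multiple of the wedge. The diagonal does not occur in the support, by
  skewness.\<close>

lemma skew_expand:
  fixes u :: "'v \<times> 'v \<Rightarrow>\<^sub>0 real"
  assumes "\<And>v w. Poly_Mapping.lookup u (v, w) = - Poly_Mapping.lookup u (w, v)"
  shows "u = (\<Sum>p\<in>Poly_Mapping.keys u.
    (Poly_Mapping.lookup u p / 2) *\<^sub>R wedge (basis_vec (fst p)) (basis_vec (snd p)))" (is "u = ?r")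
proof (rule poly_mapping_eqI)
  fix q :: "'v \<times> 'v" obtain a b where q: "q = (a, b)" by (cases q)
  let ?u = "Poly_Mapping.lookup u"
  have "Poly_Mapping.lookup ?r q = (\<Sum>p\<in>Poly_Mapping.keys u.
      (if p = (a, b) then ?u p / 2 else 0) - (if p = (b, a) then ?u p / 2 else 0))"
    unfolding lookup_sum q
  proof (rule sum.cong[OF refl])
    fix p
    show "Poly_Mapping.lookup ((?u p / 2) *\<^sub>R wedge (basis_vec (fst p)) (basis_vec (snd p))) (a, b) =
        (if p = (a, b) then ?u p / 2 else 0) - (if p = (b, a) then ?u p / 2 else 0)"
      by (subst lookup_scaleR_wedge_basis) (simp only: prod.collapse swap_simp)
  qed
  also have "\<dots> = ?u (a, b) / 2 - ?u (b, a) / 2"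
    by (simp add: sum_subtractf in_keys_iff)
  also have "\<dots> = ?u q"
    using assms[of a b] q by simp
  finally show "?u q = Poly_Mapping.lookup ?r q" ..
qed

text \<open>Membership in the span becomes a condition on coordinates, which is what the explicit
  isomorphism can check. The generators have the two properties and these survive linear
  combinations; conversely \<open>skew_expand\<close> writes such a tensor in terms of
  generators.\<close>

lemma span_wedge_edges_iff:
  "u \<in> span {wedge (basis_vec v) (basis_vec w) | v w. {v, w} \<in> E} \<longleftrightarrow>
    (\<forall>v w. Poly_Mapping.lookup u (v, w) = - Poly_Mapping.lookup u (w, v)) \<and>
    (\<forall>v w. Poly_Mapping.lookup u (v, w) \<noteq> 0 \<longrightarrow> {v, w} \<in> E)" (is "u \<in> span ?W \<longleftrightarrow> ?P u")
proof
  assume "u \<in> span ?W"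
  then show "?P u"
  proof (induction rule: span_induct_alt)
    case (step c x y)
    then obtain v w where x: "x = wedge (basis_vec v) (basis_vec w)" and e: "{v, w} \<in> E" by blast
    have "{w, v} \<in> E" using e by (simp add: insert_commute)
    then have 1: "{a, b} \<in> E" if "Poly_Mapping.lookup x (a, b) \<noteq> 0" for a b
      using e that by (auto simp: x lookup_wedge_basis split: if_splits)
    have 2: "Poly_Mapping.lookup x (a, b) = - Poly_Mapping.lookup x (b, a)" for a b
      by (simp add: x lookup_wedge)
    show ?case
    proof (intro conjI allI impI)
      fix a b
      show "Poly_Mapping.lookup (c *\<^sub>R x + y) (a, b) = - Poly_Mapping.lookup (c *\<^sub>R x + y) (b, a)"
        using 2[of a b] step(2)[THEN conjunct1, rule_format, of a b] by (simp add: lookup_add)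
      assume "Poly_Mapping.lookup (c *\<^sub>R x + y) (a, b) \<noteq> 0"
      then have "Poly_Mapping.lookup x (a, b) \<noteq> 0 \<or> Poly_Mapping.lookup y (a, b) \<noteq> 0"
        by (auto simp: lookup_add)
      then show "{a, b} \<in> E" using 1 step(2) by blast
    qed
  qed simp
next
  assume P: "?P u"
  have eq: "u = (\<Sum>p\<in>Poly_Mapping.keys u. (Poly_Mapping.lookup u p / 2) *\<^sub>R
      wedge (basis_vec (fst p)) (basis_vec (snd p)))"
    by (rule skew_expand) (use P in blast)
  have "wedge (basis_vec (fst p)) (basis_vec (snd p)) \<in> ?W" if "p \<in> Poly_Mapping.keys u" for p
    using conjunct2[OF P] that by (cases p) (auto simp: in_keys_iff)
  then have "(\<Sum>p\<in>Poly_Mapping.keys u. (Poly_Mapping.lookup u p / 2) *\<^sub>R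
      wedge (basis_vec (fst p)) (basis_vec (snd p))) \<in> span ?W"
    by (rule span_sum[OF span_scale[OF span_base]])
  then show "u \<in> span ?W"
    using eq by (rule back_subst[of "\<lambda>u. u \<in> span ?W", OF _ sym])
qed

text \<open>The analogue for the free algebra. The generators are wedges of arbitrary vectors here,
  but \<open>skew_expand\<close> needs only those of basis vectors.\<close>

lemma span_wedge_free_space_iff:
  "u \<in> span {wedge x y | x y. x \<in> free_space S \<and> y \<in> free_space S} \<longleftrightarrow>
    (\<forall>v w. Poly_Mapping.lookup u (v, w) = - Poly_Mapping.lookup u (w, v)) \<and>
    Poly_Mapping.keys u \<subseteq> S \<times> S" (is "u \<in> span ?W \<longleftrightarrow> ?P u")
proof
  assume "u \<in> span ?W"
  then show "?P u"
  proof (induction rule: span_induct_alt)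
    case (step c x y)
    then obtain v w where x: "x = wedge v w" and e: "v \<in> free_space S" "w \<in> free_space S" by blast
    have 1: "a \<in> S \<and> b \<in> S" if "Poly_Mapping.lookup x (a, b) \<noteq> 0" for a b
    proof -
      have "Poly_Mapping.lookup v a \<noteq> 0 \<and> Poly_Mapping.lookup w b \<noteq> 0 \<or>
          Poly_Mapping.lookup w a \<noteq> 0 \<and> Poly_Mapping.lookup v b \<noteq> 0"
        using that by (auto simp: x lookup_wedge)
      then show ?thesis
        using e unfolding free_space_def subset_iff in_keys_iff by blast
    qed
    have 2: "Poly_Mapping.lookup x (a, b) = - Poly_Mapping.lookup x (b, a)" for a b
      by (simp add: x lookup_wedge)
    show ?case
    proof (intro conjI allI subsetI)
      fix a b
      show "Poly_Mapping.lookup (c *\<^sub>R x + y) (a, b) = - Poly_Mapping.lookup (c *\<^sub>R x + y) (b, a)"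
        using 2[of a b] step(2)[THEN conjunct1, rule_format, of a b] by (simp add: lookup_add)
    next
      fix p
      assume "p \<in> Poly_Mapping.keys (c *\<^sub>R x + y)"
      then have "Poly_Mapping.lookup x p \<noteq> 0 \<or> Poly_Mapping.lookup y p \<noteq> 0"
        by (auto simp: lookup_add in_keys_iff)
      then show "p \<in> S \<times> S" using 1 step(2)[THEN conjunct2] by (cases p) (auto simp: subset_iff in_keys_iff)
    qed
  qed simp
next
  assume P: "?P u"
  have eq: "u = (\<Sum>p\<in>Poly_Mapping.keys u. (Poly_Mapping.lookup u p / 2) *\<^sub>R
      wedge (basis_vec (fst p)) (basis_vec (snd p)))"
    by (rule skew_expand) (use P in blast)
  have "basis_vec v \<in> free_space S" if "v \<in> S" for v
    using that by (simp add: free_space_def)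
  then have "wedge (basis_vec (fst p)) (basis_vec (snd p)) \<in> ?W" if "p \<in> Poly_Mapping.keys u" for p
    using conjunct2[OF P] that by fastforce
  then have "(\<Sum>p\<in>Poly_Mapping.keys u. (Poly_Mapping.lookup u p / 2) *\<^sub>R
      wedge (basis_vec (fst p)) (basis_vec (snd p))) \<in> span ?W"
    by (rule span_sum[OF span_scale[OF span_base]])
  then show "u \<in> span ?W"
    using eq by (rule back_subst[of "\<lambda>u. u \<in> span ?W", OF _ sym])
qed

lemma lie_carrier_n32_iff:
  "(x, u) \<in> lie_carrier n32 \<longleftrightarrow> Poly_Mapping.keys x \<subseteq> {0, 1, 2} \<and>
    (\<forall>v w. Poly_Mapping.lookup u (v, w) = - Poly_Mapping.lookup u (w, v)) \<and>
    Poly_Mapping.keys u \<subseteq> {0, 1, 2} \<times> {0, 1, 2}"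
  unfolding n32_def free_two_step_def
  by (simp only: lie_structure.simps mem_Times_iff fst_conv snd_conv span_wedge_free_space_iff)
     (simp only: free_space_def mem_Collect_eq)

text \<open>The form pairs \<open>\<real>\<^sup>3\<close> with its exterior square by \<open>(x, y \<and> z) \<mapsto> det (x, y, z)\<close>.\<close>

lemma ad_invariant_metric_n32: "\<exists>B. ad_invariant_metric n32 B"
proof -
  \<comment> \<open>For \<open>u = wedge y z\<close> the coordinates at (1, 2), (2, 0), (0, 1) are
    the components of the cross product of \<open>y\<close> and \<open>z\<close>, so the formula is
    the cofactor expansion of the determinant.\<close>
  define \<phi> :: "(nat \<Rightarrow>\<^sub>0 real) \<Rightarrow> (nat \<times> nat \<Rightarrow>\<^sub>0 real) \<Rightarrow> real" where
    "\<phi> x u = Poly_Mapping.lookup x 0 * Poly_Mapping.lookup u (1, 2)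
      + Poly_Mapping.lookup x 1 * Poly_Mapping.lookup u (2, 0)
      + Poly_Mapping.lookup x 2 * Poly_Mapping.lookup u (0, 1)" for x u
  define B where "B = (\<lambda>(x, u) (y, w). \<phi> x w + \<phi> y u)"
  have [simp]: "\<phi> 0 u = 0" "\<phi> x 0 = 0" for x u
    by (auto simp: \<phi>_def)
  have \<phi>_lin: "\<phi> (x + x') u = \<phi> x u + \<phi> x' u" "\<phi> x (u + u') = \<phi> x u + \<phi> x u'"
    "\<phi> (c *\<^sub>R x) u = c * \<phi> x u" "\<phi> x (c *\<^sub>R u) = c * \<phi> x u" for x x' u u' c
    by (auto simp: \<phi>_def lookup_add algebra_simps)
  have bil: "bilinear_on (lie_carrier n32) (lie_carrier n32) UNIV B"
    by (auto simp: bilinear_on_def linear_on_def B_def \<phi>_lin algebra_simps)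
  have nd: "x = 0 \<and> u = 0" if xu: "(x, u) \<in> lie_carrier n32"
    and h: "\<forall>q\<in>lie_carrier n32. B (x, u) q = 0" for x u
  proof -
    have b: "(basis_vec a, 0) \<in> lie_carrier n32" if "a \<in> {0, 1, 2}" for a
      using that by (simp add: lie_carrier_n32_iff)
    have w: "(0, wedge (basis_vec a) (basis_vec b)) \<in> lie_carrier n32"
      if "a \<in> {0, 1, 2}" "b \<in> {0, 1, 2}" for a b
    proof -
      have "basis_vec a \<in> free_space {0, 1, 2}" "basis_vec b \<in> free_space {0, 1, 2}"
        "0 \<in> free_space {0, 1, 2 :: nat}"
        using that by (auto simp: free_space_def)
      then show ?thesis
        unfolding n32_def free_two_step_def by (auto intro!: span_base)
    qed
    have skew: "Poly_Mapping.lookup u (i, j) = - Poly_Mapping.lookup u (j, i)" for i j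
      using xu unfolding lie_carrier_n32_iff by blast
    have kx: "Poly_Mapping.keys x \<subseteq> {0, 1, 2}" and ku: "Poly_Mapping.keys u \<subseteq> {0, 1, 2} \<times> {0, 1, 2}"
      using xu unfolding lie_carrier_n32_iff by blast+
    have "\<phi> (basis_vec a) u = 0" if "a \<in> {0, 1, 2}" for a
      using h b[OF that] by (auto simp: B_def)
    from this[of 0] this[of 1] this[of 2]
    have u: "Poly_Mapping.lookup u (0, 1) = 0" "Poly_Mapping.lookup u (1, 2) = 0"
      "Poly_Mapping.lookup u (2, 0) = 0"
      by (simp_all add: \<phi>_def lookup_single)
    have u': "Poly_Mapping.lookup u (1, 0) = 0" "Poly_Mapping.lookup u (2, 1) = 0"
      "Poly_Mapping.lookup u (0, 2) = 0" "\<And>i. Poly_Mapping.lookup u (i, i) = 0"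
      using u skew[of 0 1] skew[of 1 2] skew[of 2 0] skew[of i i for i] by auto
    have "\<phi> x (wedge (basis_vec a) (basis_vec b)) = 0" if "a \<in> {0, 1, 2}" "b \<in> {0, 1, 2}" for a b
      using h w[OF that] by (auto simp: B_def)
    from this[of 0 1] this[of 1 2] this[of 2 0]
    have x: "Poly_Mapping.lookup x 0 = 0" "Poly_Mapping.lookup x 1 = 0" "Poly_Mapping.lookup x 2 = 0"
      by (simp_all add: \<phi>_def lookup_wedge lookup_single)
    have "Poly_Mapping.lookup x i = 0" for i
      using kx x by (cases "i \<in> {0, 1, 2}") (auto simp: subset_iff in_keys_iff)
    moreover have "Poly_Mapping.lookup u (i, j) = 0" for i j
    proof (cases "(i, j) \<in> {0, 1, 2} \<times> {0, 1, 2}")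
      case True
      then show ?thesis using u u' by auto
    next
      case False
      then show ?thesis using ku unfolding subset_iff in_keys_iff by blast
    qed
    ultimately show ?thesis
      by (auto intro!: poly_mapping_eqI)
  qed
  \<comment> \<open>With \<open>x\<close>, \<open>y\<close>, \<open>z\<close> the generator parts of
    \<open>p\<close>, \<open>q\<close>, \<open>r\<close>, the two terms are det(z, x, y) and det(y,
    x, z), which differ by an odd permutation.\<close>
  have inv: "B (lie_bracket n32 p q) r + B q (lie_bracket n32 p r) = 0" for p q r
    by (auto simp: B_def n32_def free_two_step_def \<phi>_def lookup_wedge algebra_simps split: prod.split)
  have "ad_invariant_metric n32 B"
    unfolding ad_invariant_metric_def
  proof (intro conjI ballI impI)
    show "B x y = B y x" for x y
      by (auto simp: B_def split: prod.split)
    show "p = 0" if "p \<in> lie_carrier n32" "\<forall>q\<in>lie_carrier n32. B p q = 0" for p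
      using nd[of "fst p" "snd p"] that by (simp add: prod_eq_iff)
  qed (use bil inv in auto)
  then show ?thesis by blast
qed

lemma ad_invariant_metric_model:
  "\<exists>B. ad_invariant_metric (lie_direct_sum (abelian_lie s) (lie_power k n32)) B"
proof -
  obtain B where "ad_invariant_metric n32 B"
    using ad_invariant_metric_n32 by blast
  moreover have "lie_algebra n32"
    unfolding n32_def by (rule lie_algebra_free_two_step)
  ultimately show ?thesis
    using ad_invariant_metric_direct_sum[OF lie_algebra_abelian_lie ad_invariant_metric_abelian
        lie_algebra_power ad_invariant_metric_power] by blast
qed

section \<open>Graphs with an ad-invariant metric\<close>

lemma linear_on_vanishes_on_span:
  assumes "linear_on (span W) C f" and "\<And>w. w \<in> W \<Longrightarrow> f w = 0" and "u \<in> span W"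
  shows "f u = 0"
proof -
  \<comment> \<open>Membership is carried through the induction because \<open>linear_on\<close>
    gives additivity only on the span.\<close>
  have "u \<in> span W \<and> f u = 0"
    using assms(3)
  proof (induction rule: span_induct_alt)
    case base
    show ?case
      using assms(1) span_zero[of W] unfolding linear_on_def by (metis scaleR_zero_left)
  next
    case (step c x y)
    have x: "x \<in> span W" and y: "y \<in> span W"
      using step by (auto intro: span_base)
    show ?case
      using assms(1,2) step(1) x y step(2) by (simp add: linear_on_def span_scale span_add)
  qed
  then show ?thesis ..
qed

text \<open>The Steinitz bound for an indexed family. Independence in the library concerns sets, so
  \<open>g\<close> is first shown to be injective: a coincidence of two values would be a relation
  with coefficients 1 and -1.\<close>

lemma card_le_card_spanning:
  fixes g :: "'i \<Rightarrow> 'b::real_vector"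
  assumes I: "finite I" and T: "finite T" and g: "\<And>i. i \<in> I \<Longrightarrow> g i \<in> span T"
    and indep: "\<And>c i. (\<Sum>j\<in>I. c j *\<^sub>R g j) = 0 \<Longrightarrow> i \<in> I \<Longrightarrow> c i = 0"
  shows "card I \<le> card T"
proof -
  have inj: "inj_on g I"
  proof (rule inj_onI, rule ccontr)
    fix i j assume ij: "i \<in> I" "j \<in> I" "g i = g j" "i \<noteq> j"
    let ?c = "\<lambda>k. if k = i then 1 else if k = j then - 1 else 0 :: real"
    have "(\<Sum>k\<in>I. ?c k *\<^sub>R g k) = (\<Sum>k\<in>I. (if k = i then g k else 0) - (if k = j then g k else 0))"
      using ij by (intro sum.cong) auto
    also have "\<dots> = 0"
      using ij I by (simp add: sum_subtractf)
    finally show False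
      using indep[of ?c i] ij by simp
  qed
  have "independent (g ` I)"
    unfolding independent_explicit_finite_subsets
  proof (intro allI impI ballI)
    fix S c v assume S: "S \<subseteq> g ` I" "finite S" "(\<Sum>v\<in>S. c v *\<^sub>R v) = 0" "v \<in> S"
    then obtain J where J: "J \<subseteq> I" "S = g ` J"
      by (auto simp: subset_image_iff)
    have injJ: "inj_on g J"
      using inj J(1) by (rule inj_on_subset)
    have "(\<Sum>j\<in>I. (if j \<in> J then c (g j) else 0) *\<^sub>R g j) = (\<Sum>j\<in>J. c (g j) *\<^sub>R g j)"
      using J(1) I by (intro sum.mono_neutral_cong_right) auto
    also have "\<dots> = 0"
      using S(3) injJ by (simp add: J(2) sum.reindex)
    finally have *: "(\<Sum>j\<in>I. (if j \<in> J then c (g j) else 0) *\<^sub>R g j) = 0" .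
    obtain j where j: "j \<in> J" "v = g j" using S(4) J(2) by auto
    then show "c v = 0"
      using indep[OF *, of j] J(1) by auto
  qed
  then have "card (g ` I) \<le> card T"
    using independent_span_bound[OF T] g by blast
  then show ?thesis
    by (simp add: card_image inj)
qed

text \<open>In coordinates the graph bracket is the full wedge with all non-edges erased. Only the
  index pairs (a, b) and (b, a) contribute, with opposite signs.\<close>

lemma lookup_graph_bracket:
  assumes G: "finite_simple_graph V E"
  shows "Poly_Mapping.lookup (\<Sum>v\<in>V. \<Sum>w\<in>V. (Poly_Mapping.lookup x v * Poly_Mapping.lookup y w) *\<^sub>R
      graph_bracket_basis E v w) (a, b) =
    (if {a, b} \<in> E then Poly_Mapping.lookup x a * Poly_Mapping.lookup y b
       - Poly_Mapping.lookup y a * Poly_Mapping.lookup x b else 0)" (is "?l = ?r")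
proof -
  let ?c = "\<lambda>p. Poly_Mapping.lookup x (fst p) * Poly_Mapping.lookup y (snd p)"
  have fin: "finite V" and EV: "{a, b} \<in> E \<Longrightarrow> a \<in> V \<and> b \<in> V"
    using G by (auto simp: finite_simple_graph_def doubleton_eq_iff)
  have "?l = (\<Sum>p\<in>V\<times>V. Poly_Mapping.lookup (?c p *\<^sub>R graph_bracket_basis E (fst p) (snd p)) (a, b))"
    by (simp only: lookup_sum sum.cartesian_product case_prod_beta)
  also have "\<dots> = (\<Sum>p\<in>V\<times>V. if {a, b} \<in> E then
      (if p = (a, b) then ?c p else 0) - (if p = (b, a) then ?c p else 0) else 0)"
  proof (rule sum.cong[OF refl])
    fix p
    have if_keep: "P \<or> \<not> Q \<and> \<not> R \<Longrightarrow> (if P then (if Q then t else 0) - (if R then t else 0) else 0) =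
        (if Q then t else 0) - (if R then t else 0)"
      and if_zero: "\<not> P \<or> \<not> Q \<and> \<not> R \<Longrightarrow> (if P then (if Q then t else 0) - (if R then t else 0) else 0) = 0"
      for P Q R and t :: real by auto
    have e: "{fst p, snd p} = {a, b}" if "p = (a, b) \<or> p = (b, a)"
      using that by auto
    show "Poly_Mapping.lookup (?c p *\<^sub>R graph_bracket_basis E (fst p) (snd p)) (a, b) =
      (if {a, b} \<in> E then (if p = (a, b) then ?c p else 0) - (if p = (b, a) then ?c p else 0) else 0)"
    proof (cases "{fst p, snd p} \<in> E")
      case True
      have "Poly_Mapping.lookup (?c p *\<^sub>R graph_bracket_basis E (fst p) (snd p)) (a, b) =
        (if p = (a, b) then ?c p else 0) - (if p = (b, a) then ?c p else 0)"
        unfolding graph_bracket_basis_def if_P[OF True] lookup_scaleR_wedge_basis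
        by (simp only: prod.collapse swap_simp)
      moreover have "{a, b} \<in> E \<or> p \<noteq> (a, b) \<and> p \<noteq> (b, a)"
        using e True by auto
      ultimately show ?thesis
        by (simp only: if_keep)
    next
      case False
      then have "{a, b} \<notin> E \<or> p \<noteq> (a, b) \<and> p \<noteq> (b, a)"
        using e by auto
      then have "(if {a, b} \<in> E then (if p = (a, b) then ?c p else 0) - (if p = (b, a) then ?c p else 0) else 0) = 0"
        by (rule if_zero)
      then show ?thesis
        using False by (simp only: graph_bracket_basis_def if_False scaleR_zero_right lookup_zero)
    qed
  qed
  also have "\<dots> = ?r"
  proof (cases "{a, b} \<in> E")
    case True
    then show ?thesis
      using fin EV by (simp add: sum_subtractf)
  qed simp
  finally show ?thesis .
qed

lemma linear_on_rescale:
  assumes "linear_on A B f" "x \<in> A"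
  shows "f (c *\<^sub>R x) = c *\<^sub>R f x"
  using assms by (simp add: linear_on_def)

section \<open>Orthogonality forced by an ad-invariant metric, and its consequences for the
  graph\<close>

context
  fixes V :: "'v set" and E :: "'v set set" and B
  assumes G: "finite_simple_graph V E" and B: "ad_invariant_metric (graph_lie V E) B"
begin

private abbreviation "L \<equiv> lie_carrier (graph_lie V E)"
private abbreviation "br \<equiv> lie_bracket (graph_lie V E)"
private abbreviation "U \<equiv> span {wedge (basis_vec v) (basis_vec w) | v w. {v, w} \<in> E}"

private lemma finV: "finite V"
  using G by (simp add: finite_simple_graph_def)

private lemma edge_vertices: "{v, w} \<in> E \<Longrightarrow> v \<in> V \<and> w \<in> V \<and> v \<noteq> w"
  using G by (auto simp: finite_simple_graph_def doubleton_eq_iff)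

private lemma edge_endpoints: "e \<in> E \<Longrightarrow> \<exists>a b. e = {a, b} \<and> a \<noteq> b"
  using G unfolding finite_simple_graph_def by blast

private lemma carrier_vertex: "v \<in> V \<Longrightarrow> (basis_vec v, 0) \<in> L"
  by (simp add: graph_lie_def free_space_def span_zero)

private lemma carrier_U: "u \<in> U \<Longrightarrow> (0, u) \<in> L"
  by (simp add: graph_lie_def free_space_def)

private lemma subL: "subspace L"
  using lie_algebra_graph_lie[of V E] by (simp add: lie_algebra_def)

private lemma B_lin: "p \<in> L \<Longrightarrow> linear_on L UNIV (B p)" "p \<in> L \<Longrightarrow> linear_on L UNIV (\<lambda>q. B q p)"
  using B by (auto simp: ad_invariant_metric_def bilinear_on_def)

private lemma B_zero: "p \<in> L \<Longrightarrow> B p 0 = 0"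
  using linear_on_rescale[OF B_lin(1) subspace_0[OF subL], of p 0] by simp

private lemma B_inv: "p \<in> L \<Longrightarrow> q \<in> L \<Longrightarrow> r \<in> L \<Longrightarrow> B (br p q) r = - B q (br p r)"
  unfolding eq_neg_iff_add_eq_0 using B unfolding ad_invariant_metric_def by blast

private lemma B_U_lin: "p \<in> L \<Longrightarrow> linear_on U UNIV (\<lambda>u. B (0, u) p)"
  unfolding linear_on_def
proof (intro conjI ballI allI)
  fix u w assume p: "p \<in> L" and uw: "u \<in> U" "w \<in> U"
  have "B ((0, u) + (0, w)) p = B (0, u) p + B (0, w) p"
    using B_lin(2)[OF p] carrier_U uw unfolding linear_on_def by blast
  then show "B (0, u + w) p = B (0, u) p + B (0, w) p" by simp
next
  fix u c assume p: "p \<in> L" and u: "u \<in> U"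
  show "B (0, c *\<^sub>R u) p = c *\<^sub>R B (0, u) p"
    using linear_on_rescale[OF B_lin(2)[OF p] carrier_U[OF u], of c] by simp
qed simp

private lemma wedge_U: "{v, w} \<in> E \<Longrightarrow> wedge (basis_vec v) (basis_vec w) \<in> U"
  by (rule span_base) blast

text \<open>Invariance moves the bracket with \<open>v\<close> to the other argument. Every
  orthogonality statement below follows by noting that the bracket of \<open>v\<close> with
  \<open>p\<close> vanishes.\<close>

private lemma B_wedge:
  assumes "{v, w} \<in> E" "p \<in> L"
  shows "B (0, wedge (basis_vec v) (basis_vec w)) p = - B (basis_vec w, 0) (br (basis_vec v, 0) p)"
  using B_inv[of "(basis_vec v, 0)" "(basis_vec w, 0)" p] edge_vertices[OF assms(1)] assms
  by (simp add: graph_lie_bracket_basis[OF finV] carrier_vertex)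

text \<open>Elements of \<open>U\<close> are central, so \<open>B_wedge\<close> kills each
  generator, and linearity in the first argument does the rest.\<close>

private lemma B_U_U: "u \<in> U \<Longrightarrow> u' \<in> U \<Longrightarrow> B (0, u) (0, u') = 0"
proof (rule linear_on_vanishes_on_span[OF B_U_lin[OF carrier_U], of u'])
  fix w assume u': "u' \<in> U" and "w \<in> {wedge (basis_vec v) (basis_vec w) | v w. {v, w} \<in> E}"
  then obtain a b where w: "w = wedge (basis_vec a) (basis_vec b)" and ab: "{a, b} \<in> E"
    by blast
  have "br (basis_vec a, 0) (0, u') = 0"
    by (simp add: graph_lie_def zero_prod_def)
  then show "B (0, w) (0, u') = 0"
    using B_wedge[OF ab carrier_U[OF u']] edge_vertices[OF ab] by (simp add: w B_zero carrier_vertex)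
qed

private lemma B_U_isolated:
  assumes "u \<in> U" "z \<in> V" "z \<notin> \<Union>E"
  shows "B (0, u) (basis_vec z, 0) = 0"
proof (rule linear_on_vanishes_on_span[OF B_U_lin[OF carrier_vertex[OF assms(2)]] _ assms(1)])
  fix w assume "w \<in> {wedge (basis_vec v) (basis_vec w) | v w. {v, w} \<in> E}"
  then obtain a b where w: "w = wedge (basis_vec a) (basis_vec b)" and ab: "{a, b} \<in> E"
    by blast
  have "br (basis_vec a, 0) (basis_vec z, 0) = 0"
    using assms edge_vertices[OF ab] by (auto simp: graph_lie_bracket_basis[OF finV] zero_prod_def)
  then show "B (0, w) (basis_vec z, 0) = 0"
    using B_wedge[OF ab carrier_vertex[OF assms(2)]] edge_vertices[OF ab]
    by (simp add: w B_zero carrier_vertex)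
qed

text \<open>Nondegeneracy provides a test vector in the whole algebra; since \<open>U\<close> is
  orthogonal to itself and to isolated vertices, the vertices in \<open>\<Union>E\<close> already
  suffice. This is the only place where nondegeneracy is used.\<close>

private lemma U_nondegenerate:
  assumes u: "u \<in> U" and h: "\<And>z. z \<in> \<Union>E \<Longrightarrow> B (0, u) (basis_vec z, 0) = 0"
  shows "u = 0"
proof -
  have bz: "B (0, u) (basis_vec z, 0) = 0" if "z \<in> V" for z
    using h B_U_isolated[OF u that] by blast
  have "B (0, u) p = 0" if p: "p \<in> L" for p
  proof -
    obtain x u' where p': "p = (x, u')" by (cases p)
    have x: "x \<in> free_space V" and u': "u' \<in> U"
      using p by (auto simp: p' graph_lie_def)
    have e: "p = (\<Sum>v\<in>V. Poly_Mapping.lookup x v *\<^sub>R (basis_vec v, 0)) + (0, u')"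
      unfolding p' by (subst free_space_expand[OF finV x]) (simp add: sum_prod)
    have m: "(\<Sum>v\<in>V. Poly_Mapping.lookup x v *\<^sub>R (basis_vec v, 0)) \<in> L"
      by (intro subspace_sum[OF subL] subspace_scale[OF subL] carrier_vertex)
    have "B (0, u) p = B (0, u) (\<Sum>v\<in>V. Poly_Mapping.lookup x v *\<^sub>R (basis_vec v, 0)) + B (0, u) (0, u')"
      unfolding e using B_lin(1)[OF carrier_U[OF u]] m carrier_U[OF u'] unfolding linear_on_def by blast
    also have "\<dots> = 0"
      by (subst linear_on_sum[OF B_lin(1)[OF carrier_U[OF u]] subL carrier_vertex])
         (auto simp: bz B_U_U[OF u u'])
    finally show ?thesis .
  qed
  then have *: "\<forall>p\<in>L. B (0, u) p = 0"
    by (rule ballI)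
  have "\<forall>p\<in>L. (\<forall>q\<in>L. B p q = 0) \<longrightarrow> p = 0"
    using B unfolding ad_invariant_metric_def by (elim conjE)
  from bspec[OF this carrier_U[OF u]] * have "(0 :: 'v \<Rightarrow>\<^sub>0 real, u) = 0"
    by (rule mp)
  then show ?thesis by (simp add: zero_prod_def)
qed

text \<open>The wedge of an edge is nonzero, so some \<open>z\<close> pairs nontrivially with it,
  and by invariance \<open>z\<close> cannot commute with \<open>v\<close>. Exchanging
  \<open>v\<close> and \<open>w\<close> only changes the sign, so \<open>z\<close> cannot commute
  with \<open>w\<close> either.\<close>

lemma metric_edge_in_triangle:
  assumes e: "{v, w} \<in> E"
  shows "\<exists>z. {v, z} \<in> E \<and> {w, z} \<in> E"
proof -
  have vw: "v \<in> V" "w \<in> V" "v \<noteq> w" using edge_vertices[OF e] by auto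
  have "Poly_Mapping.lookup (wedge (basis_vec v) (basis_vec w)) (v, w) = 1"
    using vw(3) by (simp add: lookup_wedge_basis)
  then have "wedge (basis_vec v) (basis_vec w) \<noteq> 0"
    by auto
  then obtain z where z: "z \<in> \<Union>E" and nz: "B (0, wedge (basis_vec v) (basis_vec w)) (basis_vec z, 0) \<noteq> 0"
    using U_nondegenerate[OF wedge_U[OF e]] by blast
  have zV: "z \<in> V"
    using z G by (auto simp: finite_simple_graph_def)
  have *: "{a, z} \<in> E" if ab: "{a, b} \<in> E" and "B (0, wedge (basis_vec a) (basis_vec b)) (basis_vec z, 0) \<noteq> 0" for a b
  proof (rule ccontr)
    assume "{a, z} \<notin> E"
    then have "br (basis_vec a, 0) (basis_vec z, 0) = 0"
      using zV edge_vertices[OF ab] by (auto simp: graph_lie_bracket_basis[OF finV] zero_prod_def)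
    then show False
      using that(2) B_wedge[OF ab carrier_vertex[OF zV]] edge_vertices[OF ab]
      by (simp add: B_zero carrier_vertex)
  qed
  have "wedge (basis_vec w) (basis_vec v) = (- 1) *\<^sub>R wedge (basis_vec v) (basis_vec w)"
    by (intro poly_mapping_eqI) (auto simp: lookup_wedge)
  then have "B (0, wedge (basis_vec w) (basis_vec v)) (basis_vec z, 0) \<noteq> 0"
    using linear_on_rescale[OF B_U_lin[OF carrier_vertex[OF zV]] wedge_U[OF e], of "-1"] nz by simp
  moreover have "{w, v} \<in> E"
    using e by (simp add: insert_commute)
  ultimately show ?thesis
    using *[OF e nz] *[of w v] by blast
qed

lemma metric_card_edges_le: "card E \<le> card (\<Union>E)"
proof -
  have UV: "\<Union>E \<subseteq> V" and finE: "finite E"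
    using G finite_subset[of E "Pow V"] by (auto simp: finite_simple_graph_def)
  have finU: "finite (\<Union>E)" using finite_subset[OF UV finV] .
  have "\<exists>p. e = {fst p, snd p} \<and> fst p \<noteq> snd p" if e: "e \<in> E" for e
  proof -
    obtain a b where "e = {a, b}" "a \<noteq> b" using edge_endpoints[OF e] by blast
    then show ?thesis by (intro exI[of _ "(a, b)"]) simp
  qed
  \<comment> \<open>A wedge depends on the order of its factors, so an orientation of every edge is
    chosen.\<close>
  then obtain r where r: "\<And>e. e \<in> E \<Longrightarrow> e = {fst (r e), snd (r e)} \<and> fst (r e) \<noteq> snd (r e)"
    by metis
  define \<omega> where "\<omega> e = wedge (basis_vec (fst (r e))) (basis_vec (snd (r e)))" for e
  have \<omega>U: "\<omega> e \<in> U" if "e \<in> E" for e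
    unfolding \<omega>_def using r[OF that] that by (intro wedge_U) auto
  \<comment> \<open>The vector \<open>g e\<close> records the values on \<open>\<Union>E\<close> of
    the functional given by pairing with the wedge of \<open>e\<close>.\<close>
  define g where "g e = (\<Sum>z\<in>\<Union>E. B (0, \<omega> e) (basis_vec z, 0) *\<^sub>R basis_vec z)" for e
  have "card E \<le> card (basis_vec ` \<Union>E :: ('v \<Rightarrow>\<^sub>0 real) set)"
  proof (rule card_le_card_spanning[where g = g])
    show "g e \<in> span (basis_vec ` \<Union>E)" for e
      unfolding g_def by (intro span_sum span_scale span_base) auto
  next
    fix c e assume c: "(\<Sum>e\<in>E. c e *\<^sub>R g e) = 0" and e: "e \<in> E"
    have gl: "Poly_Mapping.lookup (g e) z = B (0, \<omega> e) (basis_vec z, 0)" if "z \<in> \<Union>E" for e z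
    proof -
      have "Poly_Mapping.lookup (g e) z = (\<Sum>y\<in>\<Union>E. if y = z then B (0, \<omega> e) (basis_vec y, 0) else 0)"
        unfolding g_def lookup_sum by (intro sum.cong refl) (auto simp: lookup_single when_def)
      then show ?thesis using that finU by simp
    qed
    have \<omega>sum: "(\<Sum>e\<in>E. c e *\<^sub>R \<omega> e) \<in> U"
      by (intro span_sum span_scale \<omega>U)
    \<comment> \<open>A relation among the functionals says that the same combination of wedges is
      orthogonal to all of \<open>\<Union>E\<close>.\<close>
    have "(\<Sum>e\<in>E. c e *\<^sub>R \<omega> e) = 0"
    proof (rule U_nondegenerate[OF \<omega>sum])
      fix z assume z: "z \<in> \<Union>E"
      have "B (0, \<Sum>e\<in>E. c e *\<^sub>R \<omega> e) (basis_vec z, 0) = (\<Sum>e\<in>E. c e *\<^sub>R B (0, \<omega> e) (basis_vec z, 0))"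
        using z UV by (intro linear_on_sum[OF B_U_lin[OF carrier_vertex]] \<omega>U) auto
      also have "\<dots> = Poly_Mapping.lookup (\<Sum>e\<in>E. c e *\<^sub>R g e) z"
        unfolding lookup_sum lookup_scaleR gl[OF z] ..
      also have "\<dots> = 0"
        unfolding c by simp
      finally show "B (0, \<Sum>e\<in>E. c e *\<^sub>R \<omega> e) (basis_vec z, 0) = 0" .
    qed
    \<comment> \<open>The coordinate at the oriented edge \<open>r e\<close> sees only the wedge of
      \<open>e\<close>: another edge has a different pair of endpoints in either order.\<close>
    then have "0 = Poly_Mapping.lookup (\<Sum>e\<in>E. c e *\<^sub>R \<omega> e) (r e)"
      by simp
    also have "\<dots> = (\<Sum>e'\<in>E. if e' = e then c e' else 0)"
      unfolding lookup_sum
    proof (rule sum.cong[OF refl])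
      fix e' assume e': "e' \<in> E"
      have "e' = e" if "r e' = r e \<or> r e' = prod.swap (r e)"
        using that r[OF e] r[OF e'] by (auto simp: insert_commute)
      moreover have "r e \<noteq> prod.swap (r e)"
        using r[OF e] by (cases "r e") auto
      ultimately show "Poly_Mapping.lookup (c e' *\<^sub>R \<omega> e') (r e) = (if e' = e then c e' else 0)"
        unfolding \<omega>_def lookup_scaleR_wedge_basis prod.collapse by auto
    qed
    also have "\<dots> = c e"
      using e finE by simp
    finally show "c e = 0" ..
  qed (use finU finE in auto)
  also have "\<dots> \<le> card (\<Union>E)"
    by (rule card_image_le[OF finU])
  finally show ?thesis .
qed

lemma metric_vertex_degree:
  assumes v: "v \<in> \<Union>E"
  shows "vertex_degree V E v = 2"
proof -
  have UV: "\<Union>E \<subseteq> V" and finE: "finite E"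
    using G finite_subset[of E "Pow V"] by (auto simp: finite_simple_graph_def)
  have finU: "finite (\<Union>E)" using finite_subset[OF UV finV] .
  \<comment> \<open>Degrees are rewritten as numbers of incident edges to allow double counting of
    incidences.\<close>
  have deg: "vertex_degree V E x = card {e \<in> E. x \<in> e}" for x
  proof -
    have "bij_betw (\<lambda>w. {x, w}) (neighbours V E x) {e \<in> E. x \<in> e}"
      unfolding bij_betw_def
    proof (intro conjI equalityI subsetI)
      show "inj_on (\<lambda>w. {x, w}) (neighbours V E x)"
        by (auto simp: inj_on_def doubleton_eq_iff)
    next
      fix e assume e: "e \<in> {e \<in> E. x \<in> e}"
      then obtain a b where "e = {a, b}" using edge_endpoints by blast
      then obtain w where w: "e = {x, w}" using e by (auto simp: insert_commute)
      then have "w \<in> V" using e UV by auto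
      then show "e \<in> (\<lambda>w. {x, w}) ` neighbours V E x"
        using e w by (auto simp: neighbours_def)
    qed (auto simp: neighbours_def)
    then show ?thesis
      by (simp add: vertex_degree_def bij_betw_same_card)
  qed
  have ge: "2 \<le> vertex_degree V E x" if x: "x \<in> \<Union>E" for x
  proof -
    obtain e where e: "e \<in> E" "x \<in> e" using x by blast
    then obtain w where w: "{x, w} \<in> E" using edge_endpoints by (metis insert_commute insertE singletonD)
    obtain z where z: "{x, z} \<in> E" "{w, z} \<in> E" using metric_edge_in_triangle[OF w] by blast
    have "{w, z} \<subseteq> neighbours V E x" "card {w, z} = 2"
      using w z edge_vertices by (auto simp: neighbours_def)
    moreover have "finite (neighbours V E x)"
      using finV by (simp add: neighbours_def)
    ultimately show ?thesis
      unfolding vertex_degree_def by (metis card_mono)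
  qed
  have "(\<Sum>x\<in>\<Union>E. vertex_degree V E x) = 2 * card E"
    unfolding deg
  proof (rule sum_multicount[OF finU finE], rule ballI)
    fix e assume e: "e \<in> E"
    then have "{x \<in> \<Union>E. x \<in> e} = e" by blast
    then show "card {x \<in> \<Union>E. x \<in> e} = 2"
      using edge_endpoints[OF e] by auto
  qed
  also have "\<dots> \<le> (\<Sum>x\<in>\<Union>E. 2)"
    using metric_card_edges_le by simp
  finally have le: "(\<Sum>x\<in>\<Union>E. vertex_degree V E x) \<le> (\<Sum>x\<in>\<Union>E. 2)" .
  show ?thesis
  proof (rule ccontr)
    assume "vertex_degree V E v \<noteq> 2"
    then have "2 < vertex_degree V E v" using ge[OF v] by simp
    \<comment> \<open>No degree is below 2, so a single larger one already exceeds the bound on the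
      sum.\<close>
    then have "(\<Sum>x\<in>\<Union>E. 2) < (\<Sum>x\<in>\<Union>E. vertex_degree V E x)"
      using ge v by (intro sum_strict_mono_ex1[OF finU]) auto
    then show False using le by simp
  qed
qed

text \<open>An edge at \<open>v\<close> lies in a triangle whose corners all have degree 2. Each
  corner has the other two as its only neighbours, so no path leaves the triangle.\<close>

lemma metric_components:
  assumes C: "C \<in> connected_components_of_graph V E"
  shows "is_3_cycle C (induced_edges E C) \<or> (\<exists>v. C = {v} \<and> vertex_degree V E v = 0)"
proof -
  let ?R = "{(a, b). {a, b} \<in> E}"
  obtain v where v: "v \<in> V" and Cv: "C = {w \<in> V. (v, w) \<in> ?R\<^sup>*}"
    using C unfolding connected_components_of_graph_def quotient_def by auto
  show ?thesis
  proof (cases "v \<in> \<Union>E")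
    case False
    have "w = v" if "(v, w) \<in> ?R\<^sup>*" for w
      using that False by (cases rule: converse_rtranclE) auto
    then have "C = {v}" using v Cv by auto
    moreover have "neighbours V E v = {}"
      using False by (auto simp: neighbours_def)
    ultimately show ?thesis by (auto simp: vertex_degree_def)
  next
    case True
    have N: "card (neighbours V E x) = 2" if "x \<in> \<Union>E" for x
      using metric_vertex_degree[OF that] by (simp add: vertex_degree_def)
    have nb: "{x, y} \<in> E \<longleftrightarrow> y \<in> neighbours V E x" for x y
      using edge_vertices by (auto simp: neighbours_def)
    have N2: "neighbours V E x = {y, z}" if "{x, y} \<in> E" "{x, z} \<in> E" "y \<noteq> z" for x y z
    proof (rule sym, rule card_subset_eq)
      show "finite (neighbours V E x)" using finV by (simp add: neighbours_def)
      show "{y, z} \<subseteq> neighbours V E x" using that nb by blast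
      show "card {y, z} = card (neighbours V E x)" using N[OF UnionI[OF that(1)]] that(3) by simp
    qed
    have "neighbours V E v \<noteq> {}" using N[OF True] by auto
    then obtain w where w: "{v, w} \<in> E" using nb by blast
    obtain z where z: "{v, z} \<in> E" "{w, z} \<in> E" using metric_edge_in_triangle[OF w] by blast
    have E': "{w, v} \<in> E" "{z, v} \<in> E" "{z, w} \<in> E"
      using w z by (simp_all add: insert_commute)
    have d: "v \<noteq> w" "w \<noteq> z" "z \<noteq> v" using edge_vertices w z by blast+
    have Nv: "neighbours V E v = {w, z}" "neighbours V E w = {v, z}" "neighbours V E z = {v, w}"
      using N2 w z E' d by blast+
    have "x \<in> {v, w, z}" if "(v, x) \<in> ?R\<^sup>*" for x
      using that
    proof (induction rule: rtrancl_induct)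
      case (step y x)
      then have "x \<in> neighbours V E y" "y \<in> {v, w, z}" using nb by auto
      then show ?case using Nv by auto
    qed simp
    moreover have "(v, w) \<in> ?R\<^sup>*" "(v, z) \<in> ?R\<^sup>*"
      using w z by auto
    ultimately have Ceq: "C = {v, w, z}"
      using Cv edge_vertices w z by auto
    have "induced_edges E C = {{v, w}, {w, z}, {z, v}}"
    proof
      show "{{v, w}, {w, z}, {z, v}} \<subseteq> induced_edges E C"
        using w z E' by (auto simp: induced_edges_def Ceq)
    next
      show "induced_edges E C \<subseteq> {{v, w}, {w, z}, {z, v}}"
      proof
        fix e assume e: "e \<in> induced_edges E C"
        then obtain a b where ab: "e = {a, b}" "a \<noteq> b"
          using edge_endpoints[of e] by (auto simp: induced_edges_def)
        then have "a \<in> {v, w, z}" "b \<in> {v, w, z}" using e by (auto simp: induced_edges_def Ceq)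
        then show "e \<in> {{v, w}, {w, z}, {z, v}}"
          using ab by (elim insertE emptyE) (simp_all add: doubleton_eq_iff)
      qed
    qed
    then have "is_3_cycle C (induced_edges E C)"
      unfolding is_3_cycle_def Ceq using d by blast
    then show ?thesis ..
  qed
qed

end

section \<open>Graphs whose components are triangles and points\<close>

lemma equiv_connected:
  "equiv V {(v, w). v \<in> V \<and> w \<in> V \<and> (v, w) \<in> {(a, b). {a, b} \<in> E}\<^sup>*}"
proof -
  have "sym ({(a, b). {a, b} \<in> E}\<^sup>*)"
    by (rule sym_rtrancl) (auto simp: sym_def insert_commute)
  then show ?thesis
    by (intro equivI) (auto simp: refl_on_def sym_def trans_def intro: rtrancl_trans)
qed

text \<open>The corners are labelled by 0, 1, 2 to match the generators of \<open>n32\<close>; any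
  labelling works, since all pairs of corners are adjacent.\<close>

lemma is_3_cycle_enumerate:
  assumes "is_3_cycle C (induced_edges E C)"
  shows "\<exists>\<tau> :: nat \<Rightarrow> 'v. bij_betw \<tau> {0, 1, 2} C \<and>
    (\<forall>a\<in>{0, 1, 2}. \<forall>b\<in>{0, 1, 2}. a \<noteq> b \<longrightarrow> {\<tau> a, \<tau> b} \<in> E)"
proof -
  obtain v1 v2 v3 where d: "v1 \<noteq> v2" "v2 \<noteq> v3" "v3 \<noteq> v1" and C: "C = {v1, v2, v3}"
    and E: "induced_edges E C = {{v1, v2}, {v2, v3}, {v3, v1}}"
    using assms by (auto simp: is_3_cycle_def)
  have e: "{v1, v2} \<in> E" "{v2, v3} \<in> E" "{v3, v1} \<in> E"
    using E by (auto simp: induced_edges_def)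
  then have e': "{v2, v1} \<in> E" "{v3, v2} \<in> E" "{v1, v3} \<in> E"
    by (simp_all add: insert_commute)
  define \<tau> where "\<tau> a = (if a = 0 then v1 else if a = 1 then v2 else v3)" for a :: nat
  have \<tau>: "\<tau> 0 = v1" "\<tau> 1 = v2" "\<tau> 2 = v3"
    by (simp_all add: \<tau>_def)
  have "bij_betw \<tau> {0, 1, 2} C"
    using d unfolding bij_betw_def inj_on_def ball_simps image_insert image_empty \<tau> C by auto
  moreover have "\<forall>a\<in>{0, 1, 2}. \<forall>b\<in>{0, 1, 2}. a \<noteq> b \<longrightarrow> {\<tau> a, \<tau> b} \<in> E"
    unfolding ball_simps \<tau> using e e' by simp
  ultimately show ?thesis by blast
qed

text \<open>The labels are the index sets of the model algebra: \<open>\<iota>\<close> lists the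
  isolated vertices and \<open>t (j, a)\<close> is corner \<open>a\<close> of triangle
  \<open>j\<close>. Adjacency then means same triangle and different corner.\<close>

lemma triangle_decomposition:
  assumes G: "finite_simple_graph V E"
    and comp: "\<And>C. C \<in> connected_components_of_graph V E \<Longrightarrow>
      is_3_cycle C (induced_edges E C) \<or> (\<exists>v. C = {v} \<and> vertex_degree V E v = 0)"
  obtains s k \<iota> and t :: "nat \<times> nat \<Rightarrow> 'v" where "bij_betw \<iota> {..<s::nat} (V - \<Union>E)"
    and "bij_betw t ({..<k} \<times> {0, 1, 2}) (\<Union>E)"
    and "\<And>v w. {v, w} \<in> E \<longleftrightarrow> (\<exists>j<k. \<exists>a\<in>{0, 1, 2}. \<exists>b\<in>{0, 1, 2}. a \<noteq> b \<and> v = t (j, a) \<and> w = t (j, b))"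
proof -
  define N where "N = ({0, 1, 2} :: nat set)"
  have finV: "finite V"
    using G by (simp add: finite_simple_graph_def)
  have edge: "v \<in> V \<and> w \<in> V \<and> v \<noteq> w" if "{v, w} \<in> E" for v w
    using that G by (auto simp: finite_simple_graph_def doubleton_eq_iff)
  define Rel where "Rel = {(v, w). v \<in> V \<and> w \<in> V \<and> (v, w) \<in> {(a, b). {a, b} \<in> E}\<^sup>*}"
  have equiv: "equiv V Rel"
    unfolding Rel_def by (rule equiv_connected)
  have comps: "connected_components_of_graph V E = V // Rel"
    by (simp add: connected_components_of_graph_def Rel_def)
  define TT where "TT = {C \<in> V // Rel. is_3_cycle C (induced_edges E C)}"
  have "finite (V // Rel)"
    by (rule finite_quotient[OF finV]) (auto simp: Rel_def)
  then have finT: "finite TT"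
    by (simp add: TT_def)
  have disj: "C = D" if "C \<in> TT" "D \<in> TT" "x \<in> C" "x \<in> D" for C D x
    using quotient_disj[OF equiv, of C D] that by (auto simp: TT_def)
  obtain c where c: "bij_betw c {0..<card TT} TT"
    using ex_bij_betw_nat_finite[OF finT] by blast
  obtain \<iota> where \<iota>: "bij_betw \<iota> {0..<card (V - \<Union>E)} (V - \<Union>E)"
    using ex_bij_betw_nat_finite[of "V - \<Union>E"] finV by blast
  have "\<forall>C\<in>TT. \<exists>\<tau>. bij_betw \<tau> N C \<and> (\<forall>a\<in>N. \<forall>b\<in>N. a \<noteq> b \<longrightarrow> {\<tau> a, \<tau> b} \<in> E)"
    using is_3_cycle_enumerate[folded N_def] by (auto simp only: TT_def mem_Collect_eq)
  then obtain \<tau> where \<tau>: "\<And>C. C \<in> TT \<Longrightarrow> bij_betw (\<tau> C) N C"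
    and \<tau>E: "\<And>C a b. C \<in> TT \<Longrightarrow> a \<in> N \<Longrightarrow> b \<in> N \<Longrightarrow> a \<noteq> b \<Longrightarrow> {\<tau> C a, \<tau> C b} \<in> E"
    by metis
  define t where "t p = \<tau> (c (fst p)) (snd p)" for p
  define k where "k = card TT"
  have cT: "c j \<in> TT" if "j < k" for j
    using c that by (auto simp: bij_betw_def k_def)
  have tc: "t (j, a) \<in> c j" if "j < k" "a \<in> N" for j a
    using \<tau>[OF cT[OF that(1)]] that(2) by (simp only: t_def fst_conv snd_conv bij_betwE)
  have edges: "{v, w} \<in> E \<longleftrightarrow> (\<exists>j<k. \<exists>a\<in>N. \<exists>b\<in>N. a \<noteq> b \<and> v = t (j, a) \<and> w = t (j, b))" for v w
  proof
    assume e: "{v, w} \<in> E"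
    note vw = edge[OF e]
    define C where "C = Rel `` {v}"
    have CQ: "C \<in> V // Rel"
      using vw by (auto simp: C_def intro: quotientI)
    have vC: "v \<in> C" "w \<in> C"
      using vw e by (auto simp: C_def Rel_def)
    \<comment> \<open>The component contains the two distinct ends of an edge, so it cannot be a
      single point.\<close>
    have "C \<in> TT"
      using comp[of C] CQ vw vC by (auto simp: comps TT_def)
    then have "C \<in> c ` {0..<card TT}"
      using bij_betw_imp_surj_on[OF c] by simp
    then obtain j where j: "j < k" "C = c j"
      by (auto simp: k_def)
    have "\<tau> C ` N = C"
      using \<tau>[OF \<open>C \<in> TT\<close>] by (simp only: bij_betw_def)
    then have "v \<in> \<tau> C ` N" "w \<in> \<tau> C ` N"
      using vC by simp_all
    then obtain a b where ab: "a \<in> N" "v = \<tau> C a" "b \<in> N" "w = \<tau> C b"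
      by (elim imageE)
    then have "a \<noteq> b" using vw by blast
    then show "\<exists>j<k. \<exists>a\<in>N. \<exists>b\<in>N. a \<noteq> b \<and> v = t (j, a) \<and> w = t (j, b)"
      unfolding t_def fst_conv snd_conv using ab j by blast
  next
    assume "\<exists>j<k. \<exists>a\<in>N. \<exists>b\<in>N. a \<noteq> b \<and> v = t (j, a) \<and> w = t (j, b)"
    then show "{v, w} \<in> E"
      unfolding t_def fst_conv snd_conv using \<tau>E[OF cT] by blast
  qed
  have "bij_betw t ({..<k} \<times> N) (\<Union>E)"
    unfolding bij_betw_def
  proof (intro conjI inj_onI equalityI subsetI)
    fix p q assume p: "p \<in> {..<k} \<times> N" and q: "q \<in> {..<k} \<times> N" and eq: "t p = t q"
    obtain j a i b where pq: "p = (j, a)" "q = (i, b)" by (cases p, cases q)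
    have jk: "j < k" "i < k" "a \<in> N" "b \<in> N" using p q by (auto simp only: pq mem_Sigma_iff lessThan_iff)
    have "c j = c i"
      using disj[OF cT[OF jk(1)] cT[OF jk(2)]] tc[OF jk(1,3)] tc[OF jk(2,4)] eq pq by simp
    then have "j = i"
      using c jk by (auto simp: bij_betw_def inj_on_def k_def)
    moreover have "a = b"
    proof (rule inj_onD)
      show "inj_on (\<tau> (c j)) N" using \<tau>[OF cT[OF jk(1)]] by (simp only: bij_betw_def)
      show "\<tau> (c j) a = \<tau> (c j) b" using eq pq \<open>j = i\<close> by (simp add: t_def)
    qed (use jk in auto)
    ultimately show "p = q" by (simp add: pq)
  next
    fix v assume "v \<in> t ` ({..<k} \<times> N)"
    then obtain j a where ja: "j < k" "a \<in> N" "v = t (j, a)" by auto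
    \<comment> \<open>Joining a corner to any other corner of its triangle shows that it is not
      isolated.\<close>
    obtain b where "b \<in> N" "a \<noteq> b"
      using ja(2) unfolding N_def by (metis insertCI zero_neq_one)
    then have "{v, t (j, b)} \<in> E"
      using edges ja by blast
    then show "v \<in> \<Union>E" by blast
  next
    fix v assume "v \<in> \<Union>E"
    then obtain e where "e \<in> E" "v \<in> e" by blast
    then obtain w where "{v, w} \<in> E"
      using G unfolding finite_simple_graph_def by (smt (verit) insert_commute insertE mem_Collect_eq singletonD subsetD)
    then show "v \<in> t ` ({..<k} \<times> N)"
      using edges by blast
  qed
  from that[OF \<iota>[unfolded atLeast0LessThan] this[unfolded N_def] edges[unfolded N_def]]
  show ?thesis .
qed

section \<open>Coordinates by finite tables, and the isomorphism with the model algebra\<close>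

definition tabulate :: "'i set \<Rightarrow> ('i \<Rightarrow> 'b::comm_monoid_add) \<Rightarrow> ('i \<Rightarrow>\<^sub>0 'b)" where
  "tabulate S f = (\<Sum>i\<in>S. Poly_Mapping.single i (f i))"

lemma lookup_tabulate:
  assumes "finite S"
  shows "Poly_Mapping.lookup (tabulate S f) i = (if i \<in> S then f i else 0)"
proof -
  have "Poly_Mapping.lookup (tabulate S f) i = (\<Sum>j\<in>S. if j = i then f j else 0)"
    unfolding tabulate_def lookup_sum lookup_single by (simp add: when_def)
  then show ?thesis
    using assms by simp
qed

lemma keys_tabulate: "finite S \<Longrightarrow> Poly_Mapping.keys (tabulate S f) \<subseteq> S"
  by (auto simp: in_keys_iff lookup_tabulate split: if_splits)

lemma tabulate_add: "tabulate S (\<lambda>i. f i + g i) = tabulate S f + tabulate S g"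
  by (simp add: tabulate_def single_add sum.distrib)

lemma tabulate_scaleR:
  "finite S \<Longrightarrow> tabulate S (\<lambda>i. c *\<^sub>R f i) = c *\<^sub>R tabulate S (f :: _ \<Rightarrow> _::real_vector)"
  by (rule poly_mapping_eqI) (simp add: lookup_tabulate)

text \<open>The map \<open>f\<close> only relabels coordinates along \<open>\<iota>\<close> and
  \<open>t\<close>. It forgets the exterior coordinates between different triangles, but these
  vanish because no edge joins two triangles.\<close>

lemma graph_lie_isomorphic_model:
  fixes t :: "nat \<times> nat \<Rightarrow> 'v"
  assumes G: "finite_simple_graph V E"
    and \<iota>: "bij_betw \<iota> {..<s::nat} (V - \<Union>E)"
    and t: "bij_betw t ({..<k} \<times> {0, 1, 2}) (\<Union>E)"
    and edges: "\<And>v w. {v, w} \<in> E \<longleftrightarrow>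
      (\<exists>j<k. \<exists>a\<in>{0, 1, 2}. \<exists>b\<in>{0, 1, 2}. a \<noteq> b \<and> v = t (j, a) \<and> w = t (j, b))"
  shows "lie_isomorphic (graph_lie V E) (lie_direct_sum (abelian_lie s) (lie_power k n32))"
proof -
  let ?l = Poly_Mapping.lookup
  define N where "N = ({0, 1, 2} :: nat set)"
  let ?U = "span {wedge (basis_vec v) (basis_vec w) | v w. {v, w} \<in> E}"
  let ?L = "lie_carrier (graph_lie V E)"
  let ?M = "lie_direct_sum (abelian_lie s) (lie_power k n32)"
  note t = t[folded N_def] and edges = edges[folded N_def]
  have finN: "finite N" "finite (N \<times> N)" by (auto simp: N_def)
  have finV: "finite V" and UV: "\<Union>E \<subseteq> V"
    using G by (auto simp: finite_simple_graph_def)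
  note n32_iff = lie_carrier_n32_iff[folded N_def]
  have subn: "subspace (lie_carrier n32)"
    using lie_algebra_free_two_step unfolding n32_def lie_algebra_def by blast
  have L_iff: "(x, u) \<in> ?L \<longleftrightarrow> Poly_Mapping.keys x \<subseteq> V \<and> u \<in> ?U" for x u
    by (simp add: graph_lie_def free_space_def)
  have M_iff: "(y, F) \<in> lie_carrier ?M \<longleftrightarrow> Poly_Mapping.keys y \<subseteq> {..<s} \<and>
      (\<forall>j. ?l F j \<in> lie_carrier n32 \<and> (j \<ge> k \<longrightarrow> ?l F j = 0))" for y F
    by (simp only: lie_direct_sum_def lie_structure.simps mem_Times_iff fst_conv snd_conv
        lie_power_carrier_iff[OF subn] abelian_lie_def mem_Collect_eq)
  define X where "X j x = tabulate N (\<lambda>a. ?l x (t (j, a)))" for j and x :: "'v \<Rightarrow>\<^sub>0 real"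
  define Y where "Y j u = tabulate (N \<times> N) (\<lambda>p. ?l u (t (j, fst p), t (j, snd p)))"
    for j and u :: "'v \<times> 'v \<Rightarrow>\<^sub>0 real"
  define A where "A x = tabulate {..<s} (\<lambda>i. ?l x (\<iota> i))" for x :: "'v \<Rightarrow>\<^sub>0 real"
  define f where "f p = (A (fst p), tabulate {..<k} (\<lambda>j. (X j (fst p), Y j (snd p))))" for p
  have lX: "?l (X j x) a = (if a \<in> N then ?l x (t (j, a)) else 0)" for j x a
    by (simp only: X_def lookup_tabulate[OF finN(1)])
  have lY: "?l (Y j u) (a, b) = (if a \<in> N \<and> b \<in> N then ?l u (t (j, a), t (j, b)) else 0)" for j u a b
    by (simp only: Y_def lookup_tabulate[OF finN(2)] mem_Times_iff fst_conv snd_conv)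
  have lA: "?l (A x) i = (if i < s then ?l x (\<iota> i) else 0)" for x i
    by (simp only: A_def lookup_tabulate[OF finite_lessThan] lessThan_iff)
  have lf: "?l (snd (f p)) j = (if j < k then (X j (fst p), Y j (snd p)) else 0)" for p j
    by (simp only: f_def snd_conv lookup_tabulate[OF finite_lessThan] lessThan_iff)
  have t_inj: "t (j, a) = t (i, b) \<longleftrightarrow> j = i \<and> a = b"
    if "j < k" "i < k" "a \<in> N" "b \<in> N" for i j a b
    using inj_on_eq_iff[OF bij_betw_imp_inj_on[OF t], of "(j, a)" "(i, b)"] that by simp
  have t_edge: "{t (j, a), t (j, b)} \<in> E \<longleftrightarrow> a \<noteq> b" if "j < k" "a \<in> N" "b \<in> N" for j a b
  proof
    assume "{t (j, a), t (j, b)} \<in> E"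
    then obtain i c d where icd: "i < k" "c \<in> N" "d \<in> N" "c \<noteq> d"
        "t (j, a) = t (i, c)" "t (j, b) = t (i, d)"
      using edges by blast
    then show "a \<noteq> b"
      using t_inj[of j i a c] t_inj[of j i b d] that by simp
  qed (use edges that in blast)
  have t_U: "t (j, a) \<in> \<Union>E" if "j < k" "a \<in> N" for j a
    using bij_betwE[OF t] that by simp
  have U_skew: "?l u (v, w) = - ?l u (w, v)" if "u \<in> ?U" for u v w
    using that unfolding span_wedge_edges_iff by blast
  have U_supp: "?l u (v, w) = 0" if "u \<in> ?U" "{v, w} \<notin> E" for u v w
    using that unfolding span_wedge_edges_iff by blast
  have Y_skew: "?l (Y j u) (a, b) = - ?l (Y j u) (b, a)" if "u \<in> ?U" for j u a b
    unfolding lY using U_skew[OF that, of "t (j, a)" "t (j, b)"] by auto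
  have f_carrier: "f p \<in> lie_carrier ?M" if p: "p \<in> ?L" for p
  proof -
    obtain x u where xu: "p = (x, u)" by (cases p)
    have u: "u \<in> ?U" using p xu L_iff by blast
    have XY: "(X j x, Y j u) \<in> lie_carrier n32" for j
      unfolding n32_iff
    proof (intro conjI allI)
      show "Poly_Mapping.keys (X j x) \<subseteq> N" "Poly_Mapping.keys (Y j u) \<subseteq> N \<times> N"
        unfolding X_def Y_def by (rule keys_tabulate[OF finN(1)], rule keys_tabulate[OF finN(2)])
    qed (rule Y_skew[OF u])
    have "?l (snd (f p)) j \<in> lie_carrier n32" for j
      using XY[of j] subspace_0[OF subn] unfolding lf by (simp add: xu)
    moreover have "?l (snd (f p)) j = 0" if "j \<ge> k" for j
      using that unfolding lf by simp
    moreover have "Poly_Mapping.keys (fst (f p)) \<subseteq> {..<s}"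
      unfolding f_def fst_conv A_def by (rule keys_tabulate) simp
    ultimately have "(fst (f p), snd (f p)) \<in> lie_carrier ?M"
      unfolding M_iff by blast
    then show ?thesis by simp
  qed
  have X_add: "X j (x + y) = X j x + X j y" and X_scale: "X j (c *\<^sub>R x) = c *\<^sub>R X j x" for j x y c
    by (simp_all add: X_def lookup_add tabulate_add flip: tabulate_scaleR[OF finN(1)])
  have Y_add: "Y j (u + w) = Y j u + Y j w" and Y_scale: "Y j (c *\<^sub>R u) = c *\<^sub>R Y j u" for j u w c
    by (simp_all add: Y_def lookup_add tabulate_add flip: tabulate_scaleR[OF finN(2)])
  have A_add: "A (x + y) = A x + A y" and A_scale: "A (c *\<^sub>R x) = c *\<^sub>R A x" for x y c
    by (simp_all add: A_def lookup_add tabulate_add flip: tabulate_scaleR[OF finite_lessThan])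
  have f_add: "f (p + q) = f p + f q" for p q
    by (simp add: f_def A_add X_add Y_add flip: tabulate_add)
  have f_scale: "f (c *\<^sub>R p) = c *\<^sub>R f p" for p c
    by (simp add: f_def A_scale X_scale Y_scale flip: tabulate_scaleR[OF finite_lessThan])
  have f_lin: "linear_on ?L (lie_carrier ?M) f"
    unfolding linear_on_def using f_carrier f_add f_scale by blast
  have f_br: "f (lie_bracket (graph_lie V E) p q) = lie_bracket ?M (f p) (f q)" for p q
  proof -
    obtain x u y w where pq: "p = (x, u)" "q = (y, w)" by (cases p, cases q)
    define S where "S = (\<Sum>v\<in>V. \<Sum>w\<in>V. (?l x v * ?l y w) *\<^sub>R graph_bracket_basis E v w)"
    have br: "lie_bracket (graph_lie V E) p q = (0, S)"
      by (simp add: pq graph_lie_def S_def)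
    have lS: "?l S (a, b) = (if {a, b} \<in> E then ?l x a * ?l y b - ?l y a * ?l x b else 0)" for a b
      unfolding S_def by (rule lookup_graph_bracket[OF G])
    have X0: "X j 0 = 0" for j
      by (rule poly_mapping_eqI) (simp add: lX)
    have A0: "A 0 = 0"
      by (rule poly_mapping_eqI) (simp add: lA)
    \<comment> \<open>Inside a triangle the only non-edges are the diagonal pairs, where the wedge
      vanishes anyway, so the graph bracket restricts to the free one.\<close>
    have YS: "Y j S = wedge (X j x) (X j y)" if "j < k" for j
    proof (rule poly_mapping_eqI)
      fix ab :: "nat \<times> nat" obtain a b where ab: "ab = (a, b)" by (cases ab)
      show "?l (Y j S) ab = ?l (wedge (X j x) (X j y)) ab"
      proof (cases "a \<in> N \<and> b \<in> N")
        case True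
        then show ?thesis
          unfolding ab lookup_wedge lY lX lS using t_edge[OF that, of a b] by (cases "a = b") simp_all
      next
        case False
        then show ?thesis
          unfolding ab lookup_wedge lY lX by auto
      qed
    qed
    have "snd (f (0, S)) = lie_bracket (lie_power k n32) (snd (f p)) (snd (f q))"
    proof (rule poly_mapping_eqI)
      fix j
      show "?l (snd (f (0, S))) j = ?l (lie_bracket (lie_power k n32) (snd (f p)) (snd (f q))) j"
        unfolding lookup_lie_power_bracket lf using YS[of j]
        by (simp add: pq X0 n32_def free_two_step_def)
    qed
    moreover have "fst (f (0, S)) = 0"
      by (simp add: f_def A0)
    moreover have "lie_bracket ?M (f p) (f q) =
        (0, lie_bracket (lie_power k n32) (snd (f p)) (snd (f q)))"
      by (simp add: lie_direct_sum_def abelian_lie_def case_prod_beta)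
    ultimately show ?thesis
      unfolding br by (simp add: prod_eq_iff)
  qed
  have f_inj: "inj_on f ?L"
  proof (rule inj_onI)
    fix p q assume p: "p \<in> ?L" and q: "q \<in> ?L" and eq: "f p = f q"
    obtain x u y w where pq: "p = (x, u)" "q = (y, w)" by (cases p, cases q)
    have kx: "Poly_Mapping.keys x \<subseteq> V" "Poly_Mapping.keys y \<subseteq> V" and uw: "u \<in> ?U" "w \<in> ?U"
      using p q unfolding pq L_iff by blast+
    have XY: "X j x = X j y \<and> Y j u = Y j w" if "j < k" for j
      using lf[of p j] lf[of q j] eq that by (simp add: pq)
    have xt: "?l x (t (j, a)) = ?l y (t (j, a))" if "j < k" "a \<in> N" for j a
      using lX[of j x a] lX[of j y a] XY[OF that(1)] that(2) by simp
    have ut: "?l u (t (j, a), t (j, b)) = ?l w (t (j, a), t (j, b))"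
      if "j < k" "a \<in> N" "b \<in> N" for j a b
      using lY[of j u a b] lY[of j w a b] XY[OF that(1)] that(2,3) by simp
    have xi: "?l x (\<iota> i) = ?l y (\<iota> i)" if "i < s" for i
      using lA[of x i] lA[of y i] eq that by (simp add: f_def pq)
    have "?l x v = ?l y v" for v
    proof (cases "v \<in> V")
      case True
      show ?thesis
      proof (cases "v \<in> \<Union>E")
        case True
        then have "v \<in> t ` ({..<k} \<times> N)"
          by (simp only: bij_betw_imp_surj_on[OF t])
        then obtain j a where "j < k" "a \<in> N" "v = t (j, a)"
          by auto
        then show ?thesis using xt by blast
      next
        case False
        with \<open>v \<in> V\<close> have "v \<in> \<iota> ` {..<s}"
          unfolding bij_betw_imp_surj_on[OF \<iota>] by (rule DiffI)
        then obtain i where "i < s" "v = \<iota> i"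
          by auto
        then show ?thesis using xi by blast
      qed
    next
      case False
      then have "v \<notin> Poly_Mapping.keys x" "v \<notin> Poly_Mapping.keys y"
        using kx by blast+
      then show ?thesis by (simp add: in_keys_iff)
    qed
    then have "x = y"
      by (rule poly_mapping_eqI)
    have uw_eq: "?l u (v, v') = ?l w (v, v')" for v v'
    proof (cases "{v, v'} \<in> E")
      case True
      then obtain j a b where "j < k" "a \<in> N" "b \<in> N" "v = t (j, a)" "v' = t (j, b)"
        using edges by blast
      then show ?thesis using ut by blast
    next
      case False
      then show ?thesis using U_supp[OF uw(1) False] U_supp[OF uw(2) False] by simp
    qed
    have "u = w"
      by (rule poly_mapping_eqI) (simp only: split_paired_all uw_eq)
    with \<open>x = y\<close> show "p = q"
      by (simp add: pq)
  qed
  have f_surj: "q \<in> f ` ?L" if q: "q \<in> lie_carrier ?M" for q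
  proof -
    obtain y F where yF: "q = (y, F)" by (cases q)
    have ky: "Poly_Mapping.keys y \<subseteq> {..<s}" and Fn: "\<And>j. ?l F j \<in> lie_carrier n32"
      and Fk: "\<And>j. j \<ge> k \<Longrightarrow> ?l F j = 0"
      using q unfolding yF M_iff by blast+
    have Fn': "(fst (?l F j), snd (?l F j)) \<in> lie_carrier n32" for j
      using Fn[of j] by simp
    have kF: "Poly_Mapping.keys (fst (?l F j)) \<subseteq> N" "Poly_Mapping.keys (snd (?l F j)) \<subseteq> N \<times> N"
      and F_skew: "?l (snd (?l F j)) (a, b) = - ?l (snd (?l F j)) (b, a)" for j a b
      using Fn'[of j] unfolding n32_iff by blast+
    define ti where "ti = inv_into ({..<k} \<times> N) t"
    define ii where "ii = inv_into {..<s} \<iota>"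
    have ti: "ti (t (j, a)) = (j, a)" if "j < k" "a \<in> N" for j a
      unfolding ti_def using that by (intro inv_into_f_f[OF bij_betw_imp_inj_on[OF t]]) simp
    have ii: "ii (\<iota> i) = i" if "i < s" for i
      unfolding ii_def using that by (intro inv_into_f_f[OF bij_betw_imp_inj_on[OF \<iota>]]) simp
    \<comment> \<open>The preimage is read off by inverting the labellings. In the definition of
      \<open>u\<close> the triangle number is taken from the first endpoint alone; on an edge both
      endpoints share it.\<close>
    define x where "x = tabulate V (\<lambda>v. if v \<in> \<Union>E then ?l (fst (?l F (fst (ti v)))) (snd (ti v))
      else ?l y (ii v))"
    define u where "u = tabulate (V \<times> V) (\<lambda>p. if {fst p, snd p} \<in> E
      then ?l (snd (?l F (fst (ti (fst p))))) (snd (ti (fst p)), snd (ti (snd p))) else 0)"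
    have finVV: "finite (V \<times> V)" using finV by simp
    have lx: "?l x v = (if v \<in> V then if v \<in> \<Union>E then ?l (fst (?l F (fst (ti v)))) (snd (ti v))
      else ?l y (ii v) else 0)" for v
      unfolding x_def lookup_tabulate[OF finV] ..
    have lu: "?l u (v, w) = (if {v, w} \<in> E
      then ?l (snd (?l F (fst (ti v)))) (snd (ti v), snd (ti w)) else 0)" for v w
    proof -
      have "(v, w) \<in> V \<times> V" if "{v, w} \<in> E"
        using that UV by blast
      then show ?thesis
        unfolding u_def lookup_tabulate[OF finVV] fst_conv snd_conv by simp
    qed
    have lut: "?l u (t (j, a), t (j, b)) = (if a \<noteq> b then ?l (snd (?l F j)) (a, b) else 0)"
      if "j < k" "a \<in> N" "b \<in> N" for j a b
      unfolding lu t_edge[OF that] ti[OF that(1,2)] ti[OF that(1,3)] by simp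
    have "u \<in> ?U"
      unfolding span_wedge_edges_iff
    proof (intro conjI allI impI)
      fix v w
      show "?l u (v, w) = - ?l u (w, v)"
      proof (cases "{v, w} \<in> E")
        case True
        then obtain j a b where j: "j < k" "a \<in> N" "b \<in> N" "v = t (j, a)" "w = t (j, b)"
          using edges by blast
        show ?thesis
          unfolding j(4,5) lut[OF j(1-3)] lut[OF j(1,3,2)] using F_skew[of j a b] by auto
      next
        case False
        then have "{w, v} \<notin> E" by (simp add: insert_commute)
        with False show ?thesis by (simp add: lu)
      qed
      show "{v, w} \<in> E" if "?l u (v, w) \<noteq> 0"
        using that unfolding lu by (simp split: if_splits)
    qed
    moreover have "Poly_Mapping.keys x \<subseteq> V"
      unfolding x_def by (rule keys_tabulate[OF finV])
    ultimately have xu: "(x, u) \<in> ?L"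
      unfolding L_iff by blast
    have "A x = y"
    proof (rule poly_mapping_eqI)
      fix i
      show "?l (A x) i = ?l y i"
      proof (cases "i < s")
        case True
        then have "\<iota> i \<in> V - \<Union>E"
          using bij_betwE[OF \<iota>] by simp
        then show ?thesis
          unfolding lA lx using True ii[OF True] by simp
      next
        case False
        then show ?thesis
          unfolding lA using ky by (auto simp: subset_iff in_keys_iff)
      qed
    qed
    moreover have "snd (f (x, u)) = F"
    proof (rule poly_mapping_eqI)
      fix j
      show "?l (snd (f (x, u))) j = ?l F j"
      proof (cases "j < k")
        case True
        have "X j x = fst (?l F j)"
        proof (rule poly_mapping_eqI)
          fix a
          show "?l (X j x) a = ?l (fst (?l F j)) a"
          proof (cases "a \<in> N")
            case aN: True
            have "t (j, a) \<in> V" using t_U[OF True aN] UV by blast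
            then show ?thesis
              unfolding lX lx using aN t_U[OF True aN] ti[OF True aN] by simp
          next
            case False
            then have "a \<notin> Poly_Mapping.keys (fst (?l F j))"
              using kF(1) by blast
            then show ?thesis unfolding lX using False by (simp add: in_keys_iff)
          qed
        qed
        moreover have "Y j u = snd (?l F j)"
        proof (rule poly_mapping_eqI)
          fix ab :: "nat \<times> nat" obtain a b where ab: "ab = (a, b)" by (cases ab)
          show "?l (Y j u) ab = ?l (snd (?l F j)) ab"
          proof (cases "a \<in> N \<and> b \<in> N")
            case abN: True
            \<comment> \<open>The edge condition in \<open>u\<close> erases the diagonal, which
              loses nothing because a skew tensor has zero diagonal.\<close>
            have "?l (snd (?l F j)) (a, a) = 0" using F_skew[of j a a] by simp
            then show ?thesis
              unfolding ab lY using abN lut[OF True, of a b] by (cases "a = b") simp_all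
          next
            case False
            then have "ab \<notin> Poly_Mapping.keys (snd (?l F j))"
              using kF(2)[of j] ab by blast
            then have "?l (snd (?l F j)) ab = 0" by (simp add: in_keys_iff)
            then show ?thesis unfolding ab lY if_not_P[OF False] by simp
          qed
        qed
        ultimately show ?thesis
          unfolding lf using True by simp
      next
        case False
        then show ?thesis
          unfolding lf using Fk[of j] by simp
      qed
    qed
    ultimately have "f (x, u) = q"
      by (simp add: yF f_def)
    then show ?thesis
      using xu by blast
  qed
  have "bij_betw f ?L (lie_carrier ?M)"
    unfolding bij_betw_def using f_inj f_surj f_carrier by blast
  moreover have "lie_hom (graph_lie V E) ?M f"
    unfolding lie_hom_def using f_lin f_br by blast
  ultimately show ?thesis
    unfolding lie_isomorphic_def by blast
qed

section \<open>Metric, components and direct sum: closing the cycle of implications\<close>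

theorem theorem3p4:
  fixes V :: "'v set" and E :: "'v set set"
  assumes "finite_simple_graph V E" and "E \<noteq> {}"
  shows "((\<exists>B. ad_invariant_metric (graph_lie V E) B) \<longleftrightarrow>
            (\<exists>s k. lie_isomorphic (graph_lie V E)
                     (lie_direct_sum (abelian_lie s) (lie_power k n32)))) \<and>
         ((\<exists>B. ad_invariant_metric (graph_lie V E) B) \<longleftrightarrow>
            (\<forall>C\<in>connected_components_of_graph V E.
               is_3_cycle C (induced_edges E C) \<or>
               (\<exists>v. C = {v} \<and> vertex_degree V E v = 0)))"
    (is "(?metric \<longleftrightarrow> ?iso) \<and> (_ \<longleftrightarrow> ?comps)")
proof -
  have "?comps" if "?metric"
    using that metric_components[OF assms(1)] by blast
  moreover have "?iso" if comps: "?comps"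
  proof (rule triangle_decomposition[OF assms(1)], goal_cases)
    case (1 C)
    with comps show ?case
      by (rule bspec)
  next
    case (2 s k \<iota> t)
    from graph_lie_isomorphic_model[OF assms(1) 2] show ?case
      by blast
  qed
  moreover have "?metric" if "?iso"
  proof -
    from that obtain s k where
      "lie_isomorphic (graph_lie V E) (lie_direct_sum (abelian_lie s) (lie_power k n32))"
      by blast
    with ad_invariant_metric_model[of s k] show ?thesis
      using ad_invariant_metric_pullback[OF _ lie_algebra_graph_lie] by blast
  qed
  ultimately show ?thesis
    by blast
qed

end
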